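(* Assume that for each $i\in\{1,2\}$ there is $\theta_i\in(0,K_i)$ such that $f_i(0)=f_i(\theta_i)=f_i(K_i)=0$, $f_i'(0)<0$, $f_i'(\theta_i)>0$, $f_i'(K_i)<0$, $f_i<0$ in $(0,\theta_i)\cup(K_i,+\infty)$, $f_i>0$ in $(-\infty,0)\cup(\theta_i,K_i)$. Let $u$ be the solution of (P) with a nonnegative continuous and compactly supported initial datum $u_0$. Then $u$ is blocked in patch 2, that is, $$u(t,x)\to0\ \text{ as }x\to+\infty,\ \text{ uniformly in }t\ge0,$$ if one of the following conditions is satisfied: (i) either $\int_0^{K_2}f_2(s)\,\mathrm{d}s<0$; (ii) or $\int_0^{K_2}f_2(s)\,\mathrm{d}s=0$ and $K_1<K_2$; (iii) or $K_1<\theta_2$ and $u_0<\theta_2$ in $\mathbb{R}$; (iv) or (P) admits a nonnegative classical stationary solution $U$ with $U(-\infty)=K_1$ and $U(+\infty)=0$, and $\|u_0\|_{L^1(\mathbb{R})}\le\varepsilon$, for some $\varepsilon>0$ depending on $f_1,f_2,d_1,d_2$, $U$ and $L$, where $L>0$ is such that the support of $u_0$ is included in $[-L,L]$ (i.e. given such a $U$ and any $L>0$, there is $\varepsilon>0$ depending only on these data such that blocking holds for all such $u_0$ with support in $[-L,L]$ and $\|u_0\|_{L^1(\mathbb{R})}\le\varepsilon$).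
   Context: Setting. Let $d_1,d_2,\sigma>0$ and let $f_1,f_2\in C^1(\mathbb{R})$, with constants $K_1,K_2>0$. Put $I_1=(-\infty,0)$ (patch 1), $I_2=(0,+\infty)$ (patch 2). Problem (P) is $$\begin{cases}u_t=d_1u_{xx}+f_1(u),& t>0,\ x<0,\\ u_t=d_2u_{xx}+f_2(u),& t>0,\ x>0,\\ u(t,0^-)=u(t,0^+),& t>0,\\ u_x(t,0^-)=\sigma u_x(t,0^+),& t>0,\end{cases}$$ with initial condition $u(0,\cdot)=u_0$. A classical solution is a continuous $u:[0,+\infty)\times\mathbb{R}\to\mathbb{R}$ with $u(0,\cdot)=u_0$, such that for $i=1,2$ the restriction of $u$ to $(0,+\infty)\times\overline{I_i}$ is $C^1$ in $t$ and $C^2$ in $x$ (up to $x=0$), and all identities in (P) hold pointwise. For every nonnegative bounded continuous $u_0$ there is a unique nonnegative bounded classical solution, called the solution of (P) with initial datum $u_0$. A classical stationary solution of (P) is a continuous $U:\mathbb{R}\to\mathbb{R}$ with $U|_{\overline{I_i}}\in C^2(\overline{I_i})$ satisfying the (time-independent) identities of (P) pointwise, i.e. $d_iU''+f_i(U)=0$ in $I_i$ and $U'(0^-)=\sigma U'(0^+)$. *)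

theory Defs
  imports "HOL-Analysis.Analysis"
begin

text \<open>Derivatives in the space variable are taken ``within'' the closed half-line, so they are
  one-sided at the interface \<open>x = 0\<close>; this encodes regularity up to the interface.\<close>

definition C2_derivs :: "real set \<Rightarrow> (real \<Rightarrow> real) \<Rightarrow> (real \<Rightarrow> real) \<Rightarrow> (real \<Rightarrow> real) \<Rightarrow> bool" where
  "C2_derivs J v v' v'' \<longleftrightarrow>
     (\<forall>x\<in>J. (v has_real_derivative v' x) (at x within J)) \<and>
     (\<forall>x\<in>J. (v' has_real_derivative v'' x) (at x within J)) \<and>
     continuous_on J v''"

definition C12_derivs :: "real set \<Rightarrow> (real \<Rightarrow> real \<Rightarrow> real) \<Rightarrow> (real \<Rightarrow> real \<Rightarrow> real) \<Rightarrow>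
    (real \<Rightarrow> real \<Rightarrow> real) \<Rightarrow> (real \<Rightarrow> real \<Rightarrow> real) \<Rightarrow> bool" where
  "C12_derivs J u ut ux uxx \<longleftrightarrow>
     (\<forall>t>0. \<forall>x\<in>J. ((\<lambda>s. u s x) has_real_derivative ut t x) (at t)) \<and>
     (\<forall>t>0. \<forall>x\<in>J. (u t has_real_derivative ux t x) (at x within J)) \<and>
     (\<forall>t>0. \<forall>x\<in>J. (ux t has_real_derivative uxx t x) (at x within J)) \<and>
     continuous_on ({0<..} \<times> J) (\<lambda>(t, x). ut t x) \<and>
     continuous_on ({0<..} \<times> J) (\<lambda>(t, x). ux t x) \<and>
     continuous_on ({0<..} \<times> J) (\<lambda>(t, x). uxx t x)"

text \<open>The matching condition \<open>u(t,0\<^sup>-) = u(t,0\<^sup>+)\<close> is part of the continuity of \<open>u\<close> on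
  \<open>[0,\<infinity>) \<times> \<real>\<close>. Values \<open>u t x\<close> with \<open>t < 0\<close> are irrelevant throughout.\<close>

definition classical_solution :: "real \<Rightarrow> real \<Rightarrow> real \<Rightarrow> (real \<Rightarrow> real) \<Rightarrow> (real \<Rightarrow> real) \<Rightarrow>
    (real \<Rightarrow> real) \<Rightarrow> (real \<Rightarrow> real \<Rightarrow> real) \<Rightarrow> bool" where
  "classical_solution d1 d2 \<sigma> f1 f2 u0 u \<longleftrightarrow>
     continuous_on ({0..} \<times> UNIV) (\<lambda>(t, x). u t x) \<and>
     (\<forall>x. u 0 x = u0 x) \<and>
     (\<exists>ut1 ux1 uxx1 ut2 ux2 uxx2.
        C12_derivs {..0} u ut1 ux1 uxx1 \<and>
        C12_derivs {0..} u ut2 ux2 uxx2 \<and>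
        (\<forall>t>0. \<forall>x<0. ut1 t x = d1 * uxx1 t x + f1 (u t x)) \<and>
        (\<forall>t>0. \<forall>x>0. ut2 t x = d2 * uxx2 t x + f2 (u t x)) \<and>
        (\<forall>t>0. ux1 t 0 = \<sigma> * ux2 t 0))"

text \<open>``The solution'' with a given nonnegative bounded continuous datum is the (unique) function
  on \<open>[0,\<infinity>) \<times> \<real>\<close> satisfying the following.\<close>

definition solution_P :: "real \<Rightarrow> real \<Rightarrow> real \<Rightarrow> (real \<Rightarrow> real) \<Rightarrow> (real \<Rightarrow> real) \<Rightarrow>
    (real \<Rightarrow> real) \<Rightarrow> (real \<Rightarrow> real \<Rightarrow> real) \<Rightarrow> bool" where
  "solution_P d1 d2 \<sigma> f1 f2 u0 u \<longleftrightarrow>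
     classical_solution d1 d2 \<sigma> f1 f2 u0 u \<and>
     (\<forall>t\<ge>0. \<forall>x. 0 \<le> u t x) \<and>
     bounded ((\<lambda>(t, x). u t x) ` ({0..} \<times> UNIV))"

definition stationary_solution :: "real \<Rightarrow> real \<Rightarrow> real \<Rightarrow> (real \<Rightarrow> real) \<Rightarrow> (real \<Rightarrow> real) \<Rightarrow>
    (real \<Rightarrow> real) \<Rightarrow> bool" where
  "stationary_solution d1 d2 \<sigma> f1 f2 U \<longleftrightarrow>
     continuous_on UNIV U \<and>
     (\<exists>U1' U1'' U2' U2''.
        C2_derivs {..0} U U1' U1'' \<and>
        C2_derivs {0..} U U2' U2'' \<and>
        (\<forall>x<0. d1 * U1'' x + f1 (U x) = 0) \<and>
        (\<forall>x>0. d2 * U2'' x + f2 (U x) = 0) \<and>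
        U1' 0 = \<sigma> * U2' 0)"

definition bistable :: "(real \<Rightarrow> real) \<Rightarrow> real \<Rightarrow> real \<Rightarrow> bool" where
  "bistable f \<theta> K \<longleftrightarrow>
     0 < \<theta> \<and> \<theta> < K \<and> f 0 = 0 \<and> f \<theta> = 0 \<and> f K = 0 \<and>
     deriv f 0 < 0 \<and> deriv f \<theta> > 0 \<and> deriv f K < 0 \<and>
     (\<forall>s\<in>{0<..<\<theta>} \<union> {K<..}. f s < 0) \<and>
     (\<forall>s\<in>{..<0} \<union> {\<theta><..<K}. f s > 0)"

definition admissible_datum :: "(real \<Rightarrow> real) \<Rightarrow> bool" where
  "admissible_datum u0 \<longleftrightarrow>
     (\<forall>x. 0 \<le> u0 x) \<and> continuous_on UNIV u0 \<and> compact (closure {x. u0 x \<noteq> 0})"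

definition blocked_in_patch2 :: "(real \<Rightarrow> real \<Rightarrow> real) \<Rightarrow> bool" where
  "blocked_in_patch2 u \<longleftrightarrow> uniform_limit {0..} (\<lambda>x t. u t x) (\<lambda>t. 0) at_top"

end

theory Submission
  imports Defs
begin

text \<open>
  Every case is settled by comparing the solution \<open>u\<close> with an explicit supersolution that tends to \<open>0\<close> as
  \<open>x \<rightarrow> +\<infinity>\<close>. The tool is the comparison principle \<open>comparison_principle\<close> for the two-patch problem on the
  whole line. It asks for the supersolution inequalities only at points where \<open>u\<close> lies above the candidate,
  so candidates may be glued from pieces.

  Let \<open>F\<close> be the primitive of \<open>f2\<close> with \<open>F 0 = 0\<close>. Wherever \<open>F < 0\<close> on \<open>(0, b)\<close>, the stationary equation of patch 2
  has a decreasing solution that comes down to \<open>0\<close> from any height below \<open>b\<close>, given by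
  \<open>d2 V'\<^sup>2 / 2 + F(V) = 0\<close> (\<open>standing_profile\<close>). As soon as \<open>u\<close> is globally bounded by a constant \<open>M < b\<close>,
  such a profile, started from height \<open>M\<close> to the right of the support of \<open>u0\<close>, blocks \<open>u\<close>
  (\<open>blocked_by_decreasing_profile\<close>). If \<open>\<integral> f2 < 0\<close>, then \<open>F < 0\<close> on all of \<open>(0, \<infinity>)\<close> and any large constant
  \<open>M\<close> serves. If \<open>K1 < \<theta>2\<close> and \<open>u0 < \<theta>2\<close>, a constant \<open>M < \<theta>2\<close> is a supersolution in both
  patches, and \<open>F < 0\<close> on \<open>(0, \<theta>2]\<close>.

  If \<open>\<integral> f2 = 0\<close> and \<open>K1 < K2\<close>, the profile is a standing wave from \<open>K2\<close> to \<open>0\<close> and has no room above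
  \<open>K2\<close>. A perturbation of it in the manner of Fife and McLeod, with an exponentially decaying excess and a bounded shift,
  controls \<open>u\<close> for all large times (\<open>blocked_if_balanced\<close>).

  If a stationary solution \<open>U\<close> from \<open>K1\<close> to \<open>0\<close> exists, it is itself the barrier, and it remains to put \<open>u\<close> below it
  at time \<open>1\<close>. Smallness of \<open>u0\<close> in \<open>L\<^sup>1\<close> gives a small Gaussian bound at that time (\<open>L1_smoothing\<close>), while \<open>U\<close> decays at most
  exponentially (\<open>stationary_lower_bound\<close>). The Gaussian bound is uniform in \<open>\<sigma>\<close>, because the comparison
  function is an even solution of the heat equation in a rescaled variable and has no flux through the interface.
\<close>

section \<open>A maximum principle across the interface\<close>

lemma second_derivative_nonpos_at_local_max:
  fixes g g' :: "real \<Rightarrow> real"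
  assumes g: "\<forall>\<^sub>F y in nhds x. (g has_real_derivative g' y) (at y)"
    and g': "(g' has_real_derivative D) (at x)"
    and max: "\<forall>\<^sub>F y in nhds x. g y \<le> g x"
  shows "D \<le> 0"
proof (rule ccontr)
  assume "\<not> D \<le> 0"
  then have "0 < D" by simp
  from g max have "\<forall>\<^sub>F y in nhds x. (g has_real_derivative g' y) (at y) \<and> g y \<le> g x"
    by eventually_elim auto
  then obtain e where "e > 0"
    and e: "\<And>y. dist y x < e \<Longrightarrow> (g has_real_derivative g' y) (at y) \<and> g y \<le> g x"
    unfolding eventually_nhds_metric by blast
  have "g' x = 0"
    using DERIV_local_max[of g "g' x" x e] e[of x] e \<open>e > 0\<close>
    by (auto simp: dist_real_def abs_minus_commute)
  obtain d where "d > 0" and d: "\<And>h. 0 < h \<Longrightarrow> h < d \<Longrightarrow> g' x < g' (x + h)"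
    using DERIV_pos_inc_right[OF g' \<open>0 < D\<close>] by auto
  define h where "h = min d e / 2"
  have h: "0 < h" "h < d" "h < e" using \<open>d > 0\<close> \<open>e > 0\<close> by (auto simp: h_def min_def)
  have "\<exists>\<xi>. x < \<xi> \<and> \<xi> < x + h \<and> g (x + h) - g x = (x + h - x) * g' \<xi>"
    using h by (intro MVT2) (auto intro!: e[THEN conjunct1] simp: dist_real_def)
  then obtain \<xi> where \<xi>: "x < \<xi>" "\<xi> < x + h" "g (x + h) - g x = h * g' \<xi>" by auto
  have "g' \<xi> > 0" using d[of "\<xi> - x"] \<xi> h \<open>g' x = 0\<close> by auto
  moreover have "g (x + h) \<le> g x" using e[of "x + h"] h by (auto simp: dist_real_def)
  ultimately show False using \<xi>(3) h by (smt (verit) mult_pos_pos)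
qed

text \<open>A penalty that tends to infinity, so that penalised bounded functions attain their suprema. Its
  slope at the interface jumps from \<open>0\<close> to \<open>-1\<close>: after subtracting a multiple of it, the flux
  inequality at the interface becomes strict for every \<open>\<sigma> > 0\<close>, which excludes a maximum there.\<close>

definition weight :: "real \<Rightarrow> real" where
  "weight x = (if x \<le> 0 then x\<^sup>2 + 2 else x\<^sup>2 - x + 2)"

lemma weight_ge: "1 \<le> weight x" "x\<^sup>2 / 2 \<le> weight x"
proof -
  have "0 \<le> (x - 1/2)^2" "0 \<le> (x-1)^2" by auto
  then show "1 \<le> weight x" "x\<^sup>2 / 2 \<le> weight x"
    by (auto simp: weight_def power2_eq_square algebra_simps)
qed

lemma weight_cont: "continuous_on UNIV weight"
proof -
  have "continuous_on ({..0} \<union> {0..}) (\<lambda>x::real. if x \<le> 0 then x\<^sup>2 + 2 else x\<^sup>2 - x + 2)"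
    by (intro continuous_on_If) (auto intro!: continuous_intros)
  moreover have "{..0} \<union> {0::real..} = UNIV" by auto
  ultimately show ?thesis by (simp add: weight_def[abs_def])
qed

lemma weight_derivs:
  assumes "x \<noteq> 0"
  shows "\<exists>w. (\<forall>\<^sub>F y in nhds x. (weight has_real_derivative w y) (at y)) \<and>
    (w has_real_derivative 2) (at x)"
proof (cases "x < 0")
  case True
  have neg: "(weight has_real_derivative 2 * y) (at y)" if "y < 0" for y
    by (rule DERIV_cong_ev[THEN iffD1, OF refl _ refl, of "\<lambda>x. x\<^sup>2 + 2"])
       (use that in \<open>auto intro!: derivative_eq_intros eventually_nhds_in_open[THEN eventually_mono, of "{..<0}"] simp: weight_def\<close>)
  have "\<forall>\<^sub>F y in nhds x. (weight has_real_derivative 2 * y) (at y)"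
    using True by (intro eventually_nhds_in_open[THEN eventually_mono, of "{..<0}"] neg) auto
  moreover have "((\<lambda>y. 2 * y) has_real_derivative 2) (at x)"
    by (auto intro!: derivative_eq_intros)
  ultimately show ?thesis by (intro exI[of _ "\<lambda>y. 2 * y"] conjI)
next
  case False
  with assms have "x > 0" by simp
  have pos: "(weight has_real_derivative 2 * y - 1) (at y)" if "y > 0" for y
    by (rule DERIV_cong_ev[THEN iffD1, OF refl _ refl, of "\<lambda>x. x\<^sup>2 - x + 2"])
       (use that in \<open>auto intro!: derivative_eq_intros eventually_nhds_in_open[THEN eventually_mono, of "{0<..}"] simp: weight_def\<close>)
  have "\<forall>\<^sub>F y in nhds x. (weight has_real_derivative 2 * y - 1) (at y)"
    using \<open>x > 0\<close> by (intro eventually_nhds_in_open[THEN eventually_mono, of "{0<..}"] pos) auto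
  moreover have "((\<lambda>y. 2 * y - 1) has_real_derivative 2) (at x)"
    by (auto intro!: derivative_eq_intros)
  ultimately show ?thesis by (intro exI[of _ "\<lambda>y. 2 * y - 1"] conjI)
qed

lemma weight_left: "(weight has_real_derivative 0) (at 0 within {..0})"
  by (rule has_field_derivative_transform_within[where d=1 and f="\<lambda>x. x\<^sup>2 + 2"])
     (auto intro!: derivative_eq_intros simp: weight_def)

lemma weight_right: "(weight has_real_derivative -1) (at 0 within {0..})"
  by (rule has_field_derivative_transform_within[where d=1 and f="\<lambda>x. x\<^sup>2 - x + 2"])
     (auto intro!: derivative_eq_intros simp: weight_def)

text \<open>If \<open>z\<close> were positive somewhere, then \<open>exp (- K (t - t0)) z - e weight\<close> would have a positive maximum, for
  small \<open>e\<close>, at some time after \<open>t0\<close>. Off the interface, the differential inequality there contradicts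
  the choice of \<open>K\<close>. At the interface, the left slope of \<open>z\<close> would be nonnegative and the right slope
  negative, against the flux inequality. The restriction to points with \<open>z > 0\<close> serves the barriers below, which
  are smooth only in regions where the solution might exceed them.\<close>

lemma parabolic_max_principle:
  fixes z :: "real \<Rightarrow> real \<Rightarrow> real"
  assumes cont: "continuous_on ({t0..} \<times> UNIV) (\<lambda>(t, x). z t x)"
    and bdd: "\<And>t x. t0 \<le> t \<Longrightarrow> z t x \<le> B"
    and init: "\<And>x. z t0 x \<le> 0"
    and const: "0 \<le> k" "0 < \<sigma>"
    and interior: "\<And>t x. t0 < t \<Longrightarrow> x \<noteq> 0 \<Longrightarrow> 0 < z t x \<Longrightarrow>
       \<exists>zt zx zxx d. 0 \<le> d \<and> d \<le> D \<and> ((\<lambda>s. z s x) has_real_derivative zt) (at t) \<and>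
         (\<forall>\<^sub>F y in nhds x. (z t has_real_derivative zx y) (at y)) \<and>
         (zx has_real_derivative zxx) (at x) \<and> zt \<le> d * zxx + k * z t x"
    and interface: "\<And>t. t0 < t \<Longrightarrow> 0 < z t 0 \<Longrightarrow>
       \<exists>l r. (z t has_real_derivative l) (at 0 within {..0}) \<and>
         (z t has_real_derivative r) (at 0 within {0..}) \<and> l \<le> \<sigma> * r"
    and "t0 \<le> t1"
  shows "z t1 x1 \<le> 0"
proof (rule ccontr)
  assume "\<not> z t1 x1 \<le> 0"
  then have pos1: "0 < z t1 x1" by simp
  \<comment> \<open>At the maximum, \<open>z\<^sub>x\<^sub>x \<le> 2 z\<close>, because \<open>weight'' = 2 \<le> 2 weight\<close> and the maximum is
    positive; the term \<open>2 \<bar>D\<bar>\<close> absorbs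
    the diffusion, and \<open>k\<close> the zeroth-order term.\<close>
  define K where "K = 2 * \<bar>D\<bar> + k + 1"
  define E where "E t = exp (- K * (t - t0))" for t
  have E: "0 < E t" for t by (simp add: E_def)
  have E1: "E t \<le> 1" if "t0 \<le> t" for t
  proof -
    have "0 \<le> K * (t - t0)" using that const by (intro mult_nonneg_nonneg) (auto simp: K_def)
    then show ?thesis by (simp add: E_def)
  qed
  define e where "e = E t1 * z t1 x1 / (2 * weight x1)"
  have wpos: "0 < weight x" for x using weight_ge(1)[of x] by linarith
  have e: "0 < e" using pos1 E wpos by (simp add: e_def)
  define n where "n t x = E t * z t x - e * weight x" for t x
  have n1: "0 < n t1 x1" using pos1 E wpos[of x1] by (simp add: n_def e_def)
  define R where "R = \<bar>x1\<bar> + 1 + 2 * \<bar>B\<bar> / e"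
  have R1: "1 \<le> R" using e by (simp add: R_def)
  have out: "n t x \<le> 0" if t: "t0 \<le> t" and x: "\<bar>x\<bar> > R" for t x
  proof -
    have "E t * z t x \<le> E t * \<bar>B\<bar>"
      using bdd[OF t, of x] E[of t] by (intro mult_left_mono) auto
    also have "\<dots> \<le> \<bar>B\<bar>" using E1[OF t] by (simp add: mult_left_le_one_le E less_imp_le)
    also have "\<dots> \<le> e * (R / 2)" using e by (auto simp: R_def field_simps)
    also have "\<dots> \<le> e * (x\<^sup>2 / 2)"
    proof -
      have "R * 1 \<le> \<bar>x\<bar> * \<bar>x\<bar>" using x R1 by (intro mult_mono) auto
      then show ?thesis using e by (simp add: power2_eq_square)
    qed
    also have "\<dots> \<le> e * weight x" using e weight_ge(2)[of x] by (intro mult_left_mono) auto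
    finally show ?thesis by (simp add: n_def)
  qed
  have "continuous_on ({t0..t1} \<times> {-R..R}) (\<lambda>p. n (fst p) (snd p))"
  proof -
    have "continuous_on ({t0..t1} \<times> {-R..R}) (\<lambda>p. z (fst p) (snd p))"
    proof -
      have "{t0..t1} \<times> {-R..R} \<subseteq> {t0..} \<times> (UNIV :: real set)" by auto
      from continuous_on_subset[OF cont this] show ?thesis by (simp add: case_prod_beta)
    qed
    moreover have "continuous_on ({t0..t1} \<times> {-R..R}) (\<lambda>p. weight (snd p))"
      by (intro continuous_on_compose2[OF weight_cont]) (auto intro!: continuous_intros)
    ultimately show ?thesis unfolding n_def E_def by (intro continuous_intros)
  qed
  moreover have "compact ({t0..t1} \<times> {-R..R})" by (intro compact_Times) auto
  moreover have mem: "(t1, x1) \<in> {t0..t1} \<times> {-R..R}"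
  proof -
    have "0 \<le> 2 * \<bar>B\<bar> / e" using e by simp
    then have "\<bar>x1\<bar> \<le> R" unfolding R_def by linarith
    then show ?thesis using \<open>t0 \<le> t1\<close> by auto
  qed
  ultimately obtain p where p: "p \<in> {t0..t1} \<times> {-R..R}"
    and pmax: "\<And>q. q \<in> {t0..t1} \<times> {-R..R} \<Longrightarrow> n (fst q) (snd q) \<le> n (fst p) (snd p)"
    using continuous_attains_sup[of "{t0..t1} \<times> {-R..R}" "\<lambda>p. n (fst p) (snd p)"] by blast
  obtain t x where tx: "p = (t, x)" by fastforce
  have npos: "0 < n t x" using pmax[OF mem] n1 tx by simp
  have nmax: "n s y \<le> n t x" if "t0 \<le> s" "s \<le> t1" for s y
  proof (cases "\<bar>y\<bar> \<le> R")
    case True then show ?thesis using pmax[of "(s, y)"] that tx by (auto simp: abs_le_iff)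
  next
    case False then show ?thesis using out[OF that(1), of y] npos by linarith
  qed
  have tt: "t0 \<le> t" "t \<le> t1" using p tx by auto
  have "t \<noteq> t0"
  proof
    assume "t = t0"
    then have "n t x \<le> - e * weight x" using init[of x] by (simp add: n_def E_def)
    moreover have "0 < e * weight x" using e wpos by simp
    ultimately show False using npos by simp
  qed
  with tt have t: "t0 < t" by simp
  have big: "e * weight x < E t * z t x" using npos by (simp add: n_def)
  have zpos: "0 < z t x"
  proof -
    have "0 < E t * z t x" using big e wpos[of x] by (smt (verit) mult_pos_pos)
    then show ?thesis using E[of t] by (simp add: zero_less_mult_iff)
  qed
  show False
  proof (cases "x = 0")
    case False
    from interior[OF t False zpos] obtain zt zx zxx d where
      d: "0 \<le> d" "d \<le> D" and zt: "((\<lambda>s. z s x) has_real_derivative zt) (at t)"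
      and zx: "\<forall>\<^sub>F y in nhds x. (z t has_real_derivative zx y) (at y)"
      and zxx: "(zx has_real_derivative zxx) (at x)" and ineq: "zt \<le> d * zxx + k * z t x"
      by blast
    \<comment> \<open>The maximum may sit at the final time \<open>t1\<close>, so only earlier times can be compared.\<close>
    have "((\<lambda>s. n s x) has_real_derivative E t * zt - K * E t * z t x) (at t)"
      unfolding n_def E_def by (auto intro!: derivative_eq_intros zt simp: algebra_simps)
    then have "0 \<le> E t * zt - K * E t * z t x"
    proof (rule contrapos_pp)
      assume "\<not> 0 \<le> E t * zt - K * E t * z t x"
      show "\<not> ((\<lambda>s. n s x) has_real_derivative E t * zt - K * E t * z t x) (at t)"
      proof
        assume der: "((\<lambda>s. n s x) has_real_derivative E t * zt - K * E t * z t x) (at t)"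
        obtain h where "h > 0" and h: "\<And>h'. 0 < h' \<Longrightarrow> h' < h \<Longrightarrow> n t x < n (t - h') x"
          using DERIV_neg_dec_left[OF der] \<open>\<not> 0 \<le> E t * zt - K * E t * z t x\<close> by auto
        define h' where "h' = min h (t - t0) / 2"
        have "0 < h'" "h' < h" "h' < t - t0" using \<open>h > 0\<close> t by (auto simp: h'_def min_def)
        then show False using h[of h'] nmax[of "t - h'" x] tt by auto
      qed
    qed
    then have "E t * (K * z t x) \<le> E t * zt" by (simp add: algebra_simps)
    then have A: "K * z t x \<le> zt" using E[of t] by simp
    obtain w where w: "\<forall>\<^sub>F y in nhds x. (weight has_real_derivative w y) (at y)"
      and w2: "(w has_real_derivative 2) (at x)" using weight_derivs[OF False] by blast
    have "E t * zxx - e * 2 \<le> 0"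
    proof (rule second_derivative_nonpos_at_local_max)
      show "\<forall>\<^sub>F y in nhds x. (n t has_real_derivative E t * zx y - e * w y) (at y)"
        using zx w unfolding n_def
        by eventually_elim (auto intro!: derivative_eq_intros)
      show "((\<lambda>y. E t * zx y - e * w y) has_real_derivative E t * zxx - e * 2) (at x)"
        by (auto intro!: derivative_eq_intros zxx w2)
      show "\<forall>\<^sub>F y in nhds x. n t y \<le> n t x"
        using nmax tt by (auto intro!: always_eventually)
    qed
    moreover have "e * 1 \<le> e * weight x" using e weight_ge(1) by (intro mult_left_mono) auto
    ultimately have "E t * zxx \<le> E t * (2 * z t x)" using big by (simp add: algebra_simps)
    then have Bx: "zxx \<le> 2 * z t x" using E[of t] by simp
    have "K * z t x \<le> d * (2 * z t x) + k * z t x"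
      using A ineq mult_left_mono[OF Bx d(1)] by linarith
    moreover have "d * (2 * z t x) \<le> \<bar>D\<bar> * (2 * z t x)"
      using d zpos by (intro mult_right_mono) auto
    ultimately have "K * z t x \<le> \<bar>D\<bar> * (2 * z t x) + k * z t x" by linarith
    then show False using zpos by (simp add: K_def algebra_simps)
  next
    case True
    from interface[OF t] zpos True obtain l r where
      l: "(z t has_real_derivative l) (at 0 within {..0})"
      and r: "(z t has_real_derivative r) (at 0 within {0..})" and lr: "l \<le> \<sigma> * r" by blast
    have nl: "(n t has_real_derivative E t * l) (at 0 within {..0})"
      unfolding n_def by (auto intro!: derivative_eq_intros l weight_left)
    have nr: "(n t has_real_derivative E t * r + e) (at 0 within {0..})"
      unfolding n_def by (auto intro!: derivative_eq_intros r weight_right)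
    have "0 \<le> E t * l"
    proof (rule ccontr)
      assume "\<not> 0 \<le> E t * l"
      then obtain h where "h > 0" "\<And>h'. 0 < h' \<Longrightarrow> 0 - h' \<in> {..0} \<Longrightarrow> h' < h \<Longrightarrow> n t 0 < n t (0 - h')"
        using has_real_derivative_neg_dec_left[OF nl] by auto
      from this(2)[of "h/2"] this(1) show False using nmax[of t "0 - h/2"] tt True by auto
    qed
    then have "0 \<le> l" using E[of t] by (simp add: zero_le_mult_iff)
    have "E t * r + e \<le> 0"
    proof (rule ccontr)
      assume "\<not> E t * r + e \<le> 0"
      then obtain h where "h > 0" "\<And>h'. 0 < h' \<Longrightarrow> 0 + h' \<in> {0..} \<Longrightarrow> h' < h \<Longrightarrow> n t 0 < n t (0 + h')"
        using has_real_derivative_pos_inc_right[OF nr] by auto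
      from this(2)[of "h/2"] this(1) show False using nmax[of t "0 + h/2"] tt True by auto
    qed
    then have "E t * r < 0" using e by linarith
    then have "r < 0" using E[of t] by (simp add: mult_less_0_iff)
    then have "\<sigma> * r < 0" using const by (simp add: mult_pos_neg)
    then show False using \<open>0 \<le> l\<close> lr by linarith
  qed
qed

section \<open>Comparison for the two-patch problem\<close>

text \<open>A pointwise notion: \<open>W\<close> has to be smooth only near the point, so that comparison functions may be glued
  from several pieces.\<close>

definition supersol_at :: "real \<Rightarrow> (real \<Rightarrow> real) \<Rightarrow> (real \<Rightarrow> real \<Rightarrow> real) \<Rightarrow> real \<Rightarrow> real \<Rightarrow> bool" where
  "supersol_at d f W t x \<longleftrightarrow>
     (\<exists>Wt Wx Wxx. ((\<lambda>s. W s x) has_real_derivative Wt) (at t) \<and>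
        (\<forall>\<^sub>F y in nhds x. (W t has_real_derivative Wx y) (at y)) \<and>
        (Wx has_real_derivative Wxx) (at x) \<and> d * Wxx + f (W t x) \<le> Wt)"

lemma C1_differentiable_on_UNIV_real:
  fixes f :: "real \<Rightarrow> real"
  assumes "f C1_differentiable_on UNIV"
  obtains f' where "\<And>s. (f has_real_derivative f' s) (at s)" "continuous_on UNIV f'"
  using assms unfolding C1_differentiable_on_def
  by (auto simp: has_real_derivative_iff_has_vector_derivative)

lemma C1_lipschitz:
  fixes f :: "real \<Rightarrow> real"
  assumes "f C1_differentiable_on UNIV"
  shows "\<exists>k>0. \<forall>s\<in>{a..b}. \<forall>r\<in>{a..b}. \<bar>f s - f r\<bar> \<le> k * \<bar>s - r\<bar>"
proof -
  obtain f' where f': "\<And>s. (f has_real_derivative f' s) (at s)" "continuous_on UNIV f'"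
    using C1_differentiable_on_UNIV_real[OF assms] by blast
  have "compact (f' ` {a..b})"
    by (intro compact_continuous_image continuous_on_subset[OF f'(2)]) auto
  then have "bounded (f' ` {a..b})" by (rule compact_imp_bounded)
  then obtain k where "k > 0" "\<forall>y \<in> f' ` {a..b}. norm y \<le> k"
    unfolding bounded_pos by blast
  then have k: "k > 0" "\<And>s. s \<in> {a..b} \<Longrightarrow> \<bar>f' s\<bar> \<le> k" by auto
  have "\<bar>f s - f r\<bar> \<le> k * \<bar>s - r\<bar>" if "s \<in> {a..b}" "r \<in> {a..b}" for s r
  proof -
    have "norm (f s - f r) \<le> k * norm (s - r)"
      using that k f' by (intro field_differentiable_bound[of "{a..b}" f f'])
        (auto intro: has_field_derivative_at_within)
    then show ?thesis by simp
  qed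
  with k(1) show ?thesis by blast
qed

lemma C12_derivs_interior:
  assumes "C12_derivs J u ut ux uxx" "0 < t" "x \<in> interior J"
  shows "((\<lambda>s. u s x) has_real_derivative ut t x) (at t)"
    and "\<forall>\<^sub>F y in nhds x. (u t has_real_derivative ux t y) (at y)"
    and "(ux t has_real_derivative uxx t x) (at x)"
proof -
  have J: "y \<in> J" "at y within J = at y" if "y \<in> interior J" for y
    using that interior_subset at_within_interior by auto
  have D: "(u t has_real_derivative ux t y) (at y)" "(ux t has_real_derivative uxx t y) (at y)"
    if "y \<in> interior J" for y
  proof -
    have "(u t has_real_derivative ux t y) (at y within J)"
      "(ux t has_real_derivative uxx t y) (at y within J)"
      using assms(1,2) J(1)[OF that] by (auto simp: C12_derivs_def)
    then show "(u t has_real_derivative ux t y) (at y)" "(ux t has_real_derivative uxx t y) (at y)"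
      by (simp_all only: J(2)[OF that])
  qed
  show "((\<lambda>s. u s x) has_real_derivative ut t x) (at t)"
    using assms J(1) by (auto simp: C12_derivs_def)
  show "\<forall>\<^sub>F y in nhds x. (u t has_real_derivative ux t y) (at y)"
    using assms(3) by (intro eventually_nhds_in_open[THEN eventually_mono, of "interior J"] D) auto
  show "(ux t has_real_derivative uxx t x) (at x)" by (rule D(2)[OF assms(3)])
qed

lemma solution_minus_supersolution:
  assumes u: "C12_derivs J u ut ux uxx" "0 < t" "x \<in> interior J"
    and eq: "ut t x = d * uxx t x + f (u t x)"
    and W: "supersol_at d f W t x"
    and lip: "f (u t x) - f (W t x) \<le> k * (u t x - W t x)"
  shows "\<exists>zt zx zxx. ((\<lambda>s. u s x - W s x) has_real_derivative zt) (at t) \<and>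
     (\<forall>\<^sub>F y in nhds x. ((\<lambda>y. u t y - W t y) has_real_derivative zx y) (at y)) \<and>
     (zx has_real_derivative zxx) (at x) \<and> zt \<le> d * zxx + k * (u t x - W t x)"
proof -
  note du = C12_derivs_interior[OF u]
  obtain Wt Wx Wxx where Wt: "((\<lambda>s. W s x) has_real_derivative Wt) (at t)"
    and Wx: "\<forall>\<^sub>F y in nhds x. (W t has_real_derivative Wx y) (at y)"
    and Wxx: "(Wx has_real_derivative Wxx) (at x)" and ineq: "d * Wxx + f (W t x) \<le> Wt"
    using W unfolding supersol_at_def by blast
  have "ut t x - Wt \<le> d * (uxx t x - Wxx) + k * (u t x - W t x)"
    using eq ineq lip by (simp add: algebra_simps)
  moreover have "((\<lambda>s. u s x - W s x) has_real_derivative ut t x - Wt) (at t)"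
    by (intro DERIV_diff du(1) Wt)
  moreover have "\<forall>\<^sub>F y in nhds x. ((\<lambda>y. u t y - W t y) has_real_derivative ux t y - Wx y) (at y)"
    using du(2) Wx by eventually_elim (intro DERIV_diff)
  moreover have "((\<lambda>y. ux t y - Wx y) has_real_derivative uxx t x - Wxx) (at x)"
    by (intro DERIV_diff du(3) Wxx)
  ultimately show ?thesis
    by (intro exI[of _ "ut t x - Wt"] exI[of _ "\<lambda>y. ux t y - Wx y"] exI[of _ "uxx t x - Wxx"]) auto
qed

text \<open>The supersolution inequalities are required only where \<open>W\<close> lies below the solution. If the solution
  is already known to be at most \<open>M\<close>, then \<open>W\<close> may be anything \<open>\<ge> M\<close> in a region where no good
  barrier is available, for instance in the whole of patch 1 and across the interface. Boundedness of the
  solution makes the reaction terms Lipschitz on the relevant range \<open>[0, B]\<close>.\<close>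

lemma comparison_principle:
  assumes sol: "solution_P d1 d2 \<sigma> f1 f2 u0 u"
    and C1: "f1 C1_differentiable_on UNIV" "f2 C1_differentiable_on UNIV"
    and pos: "0 < d1" "0 < d2" "0 < \<sigma>" "0 \<le> t0"
    and contW: "continuous_on ({t0..} \<times> UNIV) (\<lambda>(t, x). W t x)"
    and nonneg: "\<And>t x. t0 \<le> t \<Longrightarrow> 0 \<le> W t x"
    and init: "\<And>x. u t0 x \<le> W t0 x"
    and left: "\<And>t x. t0 < t \<Longrightarrow> x < 0 \<Longrightarrow> W t x < u t x \<Longrightarrow> supersol_at d1 f1 W t x"
    and right: "\<And>t x. t0 < t \<Longrightarrow> 0 < x \<Longrightarrow> W t x < u t x \<Longrightarrow> supersol_at d2 f2 W t x"
    and interface: "\<And>t. t0 < t \<Longrightarrow> W t 0 < u t 0 \<Longrightarrow>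
       \<exists>l r. (W t has_real_derivative l) (at 0 within {..0}) \<and>
         (W t has_real_derivative r) (at 0 within {0..}) \<and> \<sigma> * r \<le> l"
    and "t0 \<le> t"
  shows "u t x \<le> W t x"
proof -
  from sol have cl: "classical_solution d1 d2 \<sigma> f1 f2 u0 u"
    and upos: "\<And>t x. 0 \<le> t \<Longrightarrow> 0 \<le> u t x"
    and ubdd: "bounded ((\<lambda>(t, x). u t x) ` ({0..} \<times> UNIV))"
    by (auto simp: solution_P_def)
  from cl have contu: "continuous_on ({0..} \<times> UNIV) (\<lambda>(t, x). u t x)"
    by (simp add: classical_solution_def)
  from cl obtain ut1 ux1 uxx1 ut2 ux2 uxx2 where
    D1: "C12_derivs {..0} u ut1 ux1 uxx1" and D2: "C12_derivs {0..} u ut2 ux2 uxx2"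
    and eq1: "\<And>t x. 0 < t \<Longrightarrow> x < 0 \<Longrightarrow> ut1 t x = d1 * uxx1 t x + f1 (u t x)"
    and eq2: "\<And>t x. 0 < t \<Longrightarrow> 0 < x \<Longrightarrow> ut2 t x = d2 * uxx2 t x + f2 (u t x)"
    and fl: "\<And>t. 0 < t \<Longrightarrow> ux1 t 0 = \<sigma> * ux2 t 0"
    unfolding classical_solution_def by blast
  from ubdd obtain B where B: "\<And>t x. 0 \<le> t \<Longrightarrow> u t x \<le> B"
  proof -
    from ubdd obtain B where B: "\<forall>y \<in> (\<lambda>(t, x). u t x) ` ({0..} \<times> UNIV). norm y \<le> B"
      unfolding bounded_iff by blast
    have "u t x \<le> B" if "0 \<le> t" for t x
      using B[rule_format, of "u t x"] that by (force intro!: image_eqI[of _ _ "(t, x)"])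
    then show ?thesis using that by blast
  qed
  obtain k1 where k1: "k1 > 0" "\<And>s r. s \<in> {0..B} \<Longrightarrow> r \<in> {0..B} \<Longrightarrow> \<bar>f1 s - f1 r\<bar> \<le> k1 * \<bar>s - r\<bar>"
    using C1_lipschitz[OF C1(1), of 0 B] by blast
  obtain k2 where k2: "k2 > 0" "\<And>s r. s \<in> {0..B} \<Longrightarrow> r \<in> {0..B} \<Longrightarrow> \<bar>f2 s - f2 r\<bar> \<le> k2 * \<bar>s - r\<bar>"
    using C1_lipschitz[OF C1(2), of 0 B] by blast
  define k where "k = max k1 k2"
  define z where "z t x = u t x - W t x" for t x
  have "z t x \<le> 0"
  proof (rule parabolic_max_principle[where z=z and ?t0.0=t0 and ?t1.0=t and ?x1.0=x and B=B and k=k and D="max d1 d2" and \<sigma>=\<sigma>])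
    have "{t0..} \<times> UNIV \<subseteq> {0..} \<times> (UNIV :: real set)" using pos by auto
    from continuous_on_subset[OF contu this] contW
    show "continuous_on ({t0..} \<times> UNIV) (\<lambda>(t, x). z t x)"
      unfolding z_def case_prod_beta by (intro continuous_on_diff)
    show "z t x \<le> B" if "t0 \<le> t" for t x
      using B[of t x] nonneg[OF that, of x] that pos by (simp add: z_def)
    show "z t0 x \<le> 0" for x using init[of x] by (simp add: z_def)
    show "0 \<le> k" "0 < \<sigma>" using k1 pos by (auto simp: k_def)
    show "\<exists>zt zx zxx d. 0 \<le> d \<and> d \<le> max d1 d2 \<and> ((\<lambda>s. z s x) has_real_derivative zt) (at t) \<and>
         (\<forall>\<^sub>F y in nhds x. (z t has_real_derivative zx y) (at y)) \<and>
         (zx has_real_derivative zxx) (at x) \<and> zt \<le> d * zxx + k * z t x"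
      if t: "t0 < t" and x: "x \<noteq> 0" and zpos: "0 < z t x" for t x
    proof -
      have t': "0 < t" using t pos by simp
      have W: "W t x < u t x" using zpos by (simp add: z_def)
      have range: "u t x \<in> {0..B}" "W t x \<in> {0..B}"
        using B[of t x] upos[of t x] nonneg[of t x] W t t' by auto
      have kz: "k1 * \<bar>u t x - W t x\<bar> \<le> k * (u t x - W t x)" "k2 * \<bar>u t x - W t x\<bar> \<le> k * (u t x - W t x)"
        using W by (auto simp: k_def intro!: mult_right_mono)
      show ?thesis
      proof (cases "x < 0")
        case True
        have "f1 (u t x) - f1 (W t x) \<le> k * (u t x - W t x)"
          using k1(2)[OF range] kz(1) by linarith
        moreover have "x \<in> interior {..0}" using True by simp
        ultimately obtain zt zx zxx where
          "((\<lambda>s. z s x) has_real_derivative zt) (at t)"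
          "\<forall>\<^sub>F y in nhds x. (z t has_real_derivative zx y) (at y)"
          "(zx has_real_derivative zxx) (at x)" "zt \<le> d1 * zxx + k * z t x"
          using solution_minus_supersolution[OF D1 t' _ eq1[OF t' True] left[OF t True W]]
          unfolding z_def by blast
        then show ?thesis using pos
          by (intro exI[of _ zt] exI[of _ zx] exI[of _ zxx] exI[of _ d1]) auto
      next
        case False
        with x have xp: "0 < x" by simp
        have "f2 (u t x) - f2 (W t x) \<le> k * (u t x - W t x)"
          using k2(2)[OF range] kz(2) by linarith
        moreover have "x \<in> interior {0..}" using xp by simp
        ultimately obtain zt zx zxx where
          "((\<lambda>s. z s x) has_real_derivative zt) (at t)"
          "\<forall>\<^sub>F y in nhds x. (z t has_real_derivative zx y) (at y)"
          "(zx has_real_derivative zxx) (at x)" "zt \<le> d2 * zxx + k * z t x"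
          using solution_minus_supersolution[OF D2 t' _ eq2[OF t' xp] right[OF t xp W]]
          unfolding z_def by blast
        then show ?thesis using pos
          by (intro exI[of _ zt] exI[of _ zx] exI[of _ zxx] exI[of _ d2]) auto
      qed
    qed
    show "\<exists>l r. (z t has_real_derivative l) (at 0 within {..0}) \<and>
         (z t has_real_derivative r) (at 0 within {0..}) \<and> l \<le> \<sigma> * r"
      if t: "t0 < t" and zpos: "0 < z t 0" for t
    proof -
      have t': "0 < t" using t pos by simp
      obtain l r where l: "(W t has_real_derivative l) (at 0 within {..0})"
        and r: "(W t has_real_derivative r) (at 0 within {0..})" and lr: "\<sigma> * r \<le> l"
        using interface[OF t] zpos by (auto simp: z_def)
      have "(u t has_real_derivative ux1 t 0) (at 0 within {..0})"
        "(u t has_real_derivative ux2 t 0) (at 0 within {0..})"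
        using D1 D2 t' by (auto simp: C12_derivs_def)
      then have "(z t has_real_derivative ux1 t 0 - l) (at 0 within {..0})"
        "(z t has_real_derivative ux2 t 0 - r) (at 0 within {0..})"
        unfolding z_def using l r by (auto intro!: DERIV_diff)
      moreover have "ux1 t 0 - l \<le> \<sigma> * (ux2 t 0 - r)"
        using fl[OF t'] lr by (simp add: algebra_simps)
      ultimately show ?thesis by blast
    qed
  qed fact
  then show ?thesis by (simp add: z_def)
qed

section \<open>Decreasing stationary profiles\<close>

text \<open>Solves \<open>V' = - \<phi> V\<close> by inverting the travel time \<open>X\<close>, where \<open>X' = - 1 / \<phi>\<close>. Since \<open>\<phi>\<close> vanishes
  at least linearly at \<open>0\<close>, the travel time down to \<open>0\<close> is infinite: \<open>V\<close> stays positive and is defined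
  up to \<open>+\<infinity>\<close>. If \<open>\<phi>\<close> also vanishes linearly at \<open>b\<close>, the solution is global and connects \<open>b\<close>
  to \<open>0\<close>.\<close>

lemma decreasing_solution_autonomous_ode:
  fixes \<phi> :: "real \<Rightarrow> real"
  assumes b: "0 < b" and C: "0 < C"
    and pos: "\<And>v. 0 < v \<Longrightarrow> v < b \<Longrightarrow> 0 < \<phi> v"
    and cont: "\<And>v. 0 < v \<Longrightarrow> v < b \<Longrightarrow> isCont \<phi> v"
    and lin: "\<And>v. 0 < v \<Longrightarrow> v < b \<Longrightarrow> \<phi> v \<le> C * v"
  obtains V J where "open J" "\<And>x y. x \<in> J \<Longrightarrow> x \<le> y \<Longrightarrow> y \<in> J"
    "\<And>x. x \<in> J \<Longrightarrow> 0 < V x \<and> V x < b \<and> (V has_real_derivative - \<phi> (V x)) (at x)"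
    "\<And>v. 0 < v \<Longrightarrow> v < b \<Longrightarrow> \<exists>x\<in>J. V x = v"
    "\<And>x y. x \<in> J \<Longrightarrow> x < y \<Longrightarrow> V y < V x"
    "(V \<longlongrightarrow> 0) at_top"
    "(\<And>v. 0 < v \<Longrightarrow> v < b \<Longrightarrow> \<phi> v \<le> C * (b - v)) \<Longrightarrow> J = UNIV \<and> (V \<longlongrightarrow> b) at_bot"
proof -
  obtain X where X: "\<And>v. 0 < v \<Longrightarrow> v < b \<Longrightarrow> (X has_real_derivative - 1 / \<phi> v) (at v)"
  proof -
    have "\<exists>F. \<forall>x. ereal 0 < ereal x \<longrightarrow> ereal x < ereal b \<longrightarrow>
        (F has_vector_derivative - 1 / \<phi> x) (at x)"
    proof (rule einterval_antiderivative)
      show "ereal 0 < ereal b" using b by simp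
      fix x assume "ereal 0 < ereal x" "ereal x < ereal b"
      then show "isCont (\<lambda>x. - 1 / \<phi> x) x"
        using pos[of x] cont[of x] by (auto intro!: continuous_intros)
    qed
    then show ?thesis using that
      by (auto simp: has_real_derivative_iff_has_vector_derivative)
  qed
  let ?S = "{0<..<b}"
  have dec: "X w < X v" if "0 < v" "v < w" "w < b" for v w
  proof (rule DERIV_neg_imp_decreasing[OF that(2)])
    fix x assume "v \<le> x" "x \<le> w"
    then have "0 < x" "x < b" using that by auto
    then show "\<exists>y. (X has_real_derivative y) (at x) \<and> y < 0"
      using X[of x] pos[of x] by (intro exI[of _ "- 1 / \<phi> x"]) auto
  qed
  have inj: "inj_on X ?S"
  proof (rule inj_onI)
    fix v w assume "v \<in> ?S" "w \<in> ?S" "X v = X w"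
    then show "v = w" using dec[of v w] dec[of w v] by (cases v w rule: linorder_cases) auto
  qed
  have Xcont: "continuous_on ?S X"
    using X by (intro DERIV_continuous_on[where D="\<lambda>v. - 1 / \<phi> v"]) (auto intro: has_field_derivative_at_within)
  define J where "J = X ` ?S"
  define V where "V = inv_into ?S X"
  have VX: "V (X v) = v" if "0 < v" "v < b" for v
    using that inj by (simp add: V_def)
  have Vin: "0 < V x" "V x < b" "X (V x) = x" if "x \<in> J" for x
    using that VX by (auto simp: J_def)
  have "open J"
    unfolding J_def by (rule injective_into_1d_imp_open_map_UNIV[OF _ Xcont inj]) auto
  have "connected J" unfolding J_def by (intro connected_continuous_image Xcont) auto
  \<comment> \<open>\<open>X v + ln v / C\<close> is nonincreasing, hence \<open>X\<close> grows at least like \<open>- ln v / C\<close> as \<open>v\<close> tends to 0.\<close>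
  have unb: "\<exists>v. 0 < v \<and> v < b \<and> N \<le> X v" for N
  proof -
    define c where "c = b / 2"
    have c: "0 < c" "c < b" using b by (auto simp: c_def)
    define v where "v = c * exp (- C * max 0 (N - X c))"
    have e1: "exp (- C * max 0 (N - X c)) \<le> 1" using C by auto
    have v: "0 < v" "v \<le> c"
      using c e1 by (auto simp: v_def mult_le_cancel_left1)
    have "X c + ln c / C \<le> X v + ln v / C"
    proof (rule DERIV_nonpos_imp_nonincreasing[OF v(2)])
      fix x assume "v \<le> x" "x \<le> c"
      then have x: "0 < x" "x < b" using v c by auto
      have "1 / (C * x) \<le> 1 / \<phi> x" using lin[OF x] pos[OF x] C x by (intro divide_left_mono) auto
      then show "\<exists>y. ((\<lambda>v. X v + ln v / C) has_real_derivative y) (at x) \<and> y \<le> 0"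
        using x C X[OF x] by (intro exI[of _ "- 1 / \<phi> x + 1 / (C * x)"])
          (auto intro!: derivative_eq_intros)
    qed
    moreover have "ln v / C = ln c / C - max 0 (N - X c)"
      using c C by (simp add: v_def ln_mult diff_divide_distrib)
    ultimately have "N \<le> X v" by linarith
    then show ?thesis using v c by (intro exI[of _ v]) auto
  qed
  have up: "y \<in> J" if "x \<in> J" "x \<le> y" for x y
  proof -
    obtain v where "0 < v" "v < b" "y \<le> X v" using unb[of y] by blast
    then have "X v \<in> J" by (auto simp: J_def)
    with \<open>connected J\<close> that \<open>y \<le> X v\<close> show ?thesis
      by (meson connectedD_interval)
  qed
  have Vdec: "V y < V x" if "x \<in> J" "x < y" for x y
  proof -
    have y: "y \<in> J" using up that by auto
    show ?thesis
      using Vin[OF y] Vin[OF \<open>x \<in> J\<close>] dec[of "V x" "V y"] that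
      by (cases "V x" "V y" rule: linorder_cases) auto
  qed
  have Vder: "(V has_real_derivative - \<phi> (V x)) (at x)" if "x \<in> J" for x
  proof -
    note v = Vin[OF that]
    have "(V has_real_derivative inverse (- 1 / \<phi> (V x))) (at (X (V x)))"
      unfolding has_field_derivative_def
    proof (rule has_derivative_inverse_strong[where S="?S" and f=X and x="V x"])
      show "(X has_derivative (*) (- 1 / \<phi> (V x))) (at (V x))"
        using X[of "V x"] v by (simp add: has_field_derivative_def)
      show "(*) (- 1 / \<phi> (V x)) \<circ> (*) (inverse (- 1 / \<phi> (V x))) = id"
        using pos[of "V x"] v by (auto simp: fun_eq_iff)
    qed (use v Xcont VX in auto)
    then show ?thesis using v by simp
  qed
  have lim0: "(V \<longlongrightarrow> 0) at_top"
  proof (rule tendstoI)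
    fix e :: real assume "0 < e"
    define c where "c = min e b / 2"
    have c: "0 < c" "c < b" "c < e" using b \<open>0 < e\<close> by (auto simp: c_def min_def)
    have XJ: "X c \<in> J" using c by (auto simp: J_def)
    have "dist (V x) 0 < e" if "X c < x" for x
      using Vdec[OF XJ that] VX[OF c(1,2)] Vin[OF up[OF XJ, of x]] that c by auto
    then show "\<forall>\<^sub>F x in at_top. dist (V x) 0 < e"
      by (rule eventually_mono[OF eventually_gt_at_top[of "X c"]])
  qed
  have top: "J = UNIV \<and> (V \<longlongrightarrow> b) at_bot"
    if lin2: "\<And>v. 0 < v \<Longrightarrow> v < b \<Longrightarrow> \<phi> v \<le> C * (b - v)"
  proof -
    have unb2: "\<exists>v. 0 < v \<and> v < b \<and> X v \<le> N" for N
    proof -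
      define c where "c = b / 2"
      have c: "0 < c" "c < b" using b by (auto simp: c_def)
      define v where "v = b - (b - c) * exp (- C * max 0 (X c - N))"
      have e1: "exp (- C * max 0 (X c - N)) \<le> 1" using C by auto
      have "(b - c) * exp (- C * max 0 (X c - N)) \<le> b - c"
        using c e1 by (intro mult_left_le) auto
      moreover have "0 < (b - c) * exp (- C * max 0 (X c - N))" using c by simp
      ultimately have v: "c \<le> v" "v < b" unfolding v_def by linarith+
      have "X v - ln (b - v) / C \<le> X c - ln (b - c) / C"
      proof (rule DERIV_nonpos_imp_nonincreasing[OF v(1)])
        fix x assume "c \<le> x" "x \<le> v"
        then have x: "0 < x" "x < b" using v c by auto
        have "1 / (C * (b - x)) \<le> 1 / \<phi> x"
          using lin2[OF x] pos[OF x] C x by (intro divide_left_mono) auto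
        then show "\<exists>y. ((\<lambda>v. X v - ln (b - v) / C) has_real_derivative y) (at x) \<and> y \<le> 0"
          using x C X[OF x] by (intro exI[of _ "- 1 / \<phi> x + 1 / (C * (b - x))"])
            (auto intro!: derivative_eq_intros simp: field_simps)
      qed
      moreover have "ln (b - v) / C = ln (b - c) / C - max 0 (X c - N)"
        using c C by (simp add: v_def ln_mult diff_divide_distrib)
      ultimately have "X v \<le> N" by linarith
      then show ?thesis using v c by (intro exI[of _ v]) auto
    qed
    have "x \<in> J" for x
    proof -
      obtain v where "0 < v" "v < b" "X v \<le> x" using unb2[of x] by blast
      then show ?thesis using up[of "X v" x] by (auto simp: J_def)
    qed
    then have JU: "J = UNIV" by auto
    have "(V \<longlongrightarrow> b) at_bot"
    proof (rule tendstoI)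
      fix e :: real assume "0 < e"
      define c where "c = max (b - e) 0 / 2 + b / 2"
      have c: "0 < c" "c < b" "b - c < e" using b \<open>0 < e\<close> by (auto simp: c_def max_def field_simps)
      have "dist (V x) b < e" if "x < X c" for x
        using Vdec[of x "X c"] VX[OF c(1,2)] Vin[of x] that c JU by (auto simp: dist_real_def)
      then show "\<forall>\<^sub>F x in at_bot. dist (V x) b < e"
        by (rule eventually_mono[OF eventually_gt_at_bot[of "X c"]])
    qed
    with JU show ?thesis by simp
  qed
  show ?thesis
  proof (rule that[of J V])
    show "\<exists>x\<in>J. V x = v" if "0 < v" "v < b" for v
      using VX that by (auto simp: J_def)
    show "J = UNIV \<and> (V \<longlongrightarrow> b) at_bot"
      if "\<And>v. 0 < v \<Longrightarrow> v < b \<Longrightarrow> \<phi> v \<le> C * (b - v)" using top that by blast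
  qed (use \<open>open J\<close> up Vin Vder Vdec lim0 in auto)
qed

lemma C1_potential_derivative:
  assumes "f C1_differentiable_on UNIV" "0 < v"
  shows "((\<lambda>v. integral {0..v} f) has_real_derivative f v) (at v)"
proof -
  have "continuous_on {0..v+1} f"
    using assms(1) by (meson C1_differentiable_imp_continuous_on continuous_on_subset subset_UNIV)
  then have "((\<lambda>v. integral {0..v} f) has_real_derivative f v) (at v within {0..v+1})"
    using assms(2) by (intro integral_has_real_derivative) auto
  moreover have "at v within {0..v+1} = at v" using assms(2) by (intro at_within_interior) auto
  ultimately show ?thesis by simp
qed

lemma C1_potential_cont:
  assumes "f C1_differentiable_on UNIV"
  shows "continuous_on {0..c} (\<lambda>v. integral {0..v} (f :: real \<Rightarrow> real))"
proof -
  have "continuous_on {0..c} f"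
    using assms(1) by (meson C1_differentiable_imp_continuous_on continuous_on_subset subset_UNIV)
  then show ?thesis by (intro indefinite_integral_continuous_1 integrable_continuous_real)
qed

text \<open>A decreasing stationary profile of \<open>d V'' + f(V) = 0\<close> that tends to \<open>0\<close>. The first integral
  \<open>d V'\<^sup>2 / 2 + F(V) = 0\<close>, with \<open>F\<close> the primitive of \<open>f\<close>, reduces it to the first-order equation
  above with \<open>\<phi> = sqrt (- 2 F / d)\<close>; negativity of \<open>F\<close> on \<open>(0, b)\<close> is what lets the profile come
  down from any height below \<open>b\<close>. In the balanced case \<open>F(b) = 0\<close> the profile is the standing wave
  between \<open>b\<close> and \<open>0\<close>. On \<open>J\<close> the derivative of \<open>V\<close> is \<open>- \<phi> \<circ> V\<close>, and its
  second derivative is given through that expression.\<close>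

lemma standing_profile:
  fixes f :: "real \<Rightarrow> real"
  assumes C1: "f C1_differentiable_on UNIV" and d: "0 < d" and b: "0 < b" and f0: "f 0 = 0"
    and neg: "\<And>v. 0 < v \<Longrightarrow> v < b \<Longrightarrow> integral {0..v} f < 0"
  obtains V J \<phi> where "open J" "\<And>x y. x \<in> J \<Longrightarrow> x \<le> y \<Longrightarrow> y \<in> J"
    "\<And>v. 0 < v \<Longrightarrow> v < b \<Longrightarrow> 0 < \<phi> v" "continuous_on {0<..<b} \<phi>"
    "\<And>x. x \<in> J \<Longrightarrow> 0 < V x \<and> V x < b"
    "\<And>x. x \<in> J \<Longrightarrow> (V has_real_derivative - \<phi> (V x)) (at x)"
    "\<And>x. x \<in> J \<Longrightarrow> ((\<lambda>y. - \<phi> (V y)) has_real_derivative - f (V x) / d) (at x)"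
    "\<And>v. 0 < v \<Longrightarrow> v < b \<Longrightarrow> \<exists>x\<in>J. V x = v"
    "\<And>x y. x \<in> J \<Longrightarrow> x < y \<Longrightarrow> V y < V x"
    "(V \<longlongrightarrow> 0) at_top"
    "f b = 0 \<Longrightarrow> integral {0..b} f = 0 \<Longrightarrow> J = UNIV \<and> (V \<longlongrightarrow> b) at_bot"
proof -
  define F where "F v = integral {0..v} f" for v
  have F': "(F has_real_derivative f v) (at v)" if "0 < v" for v
    using C1_potential_derivative[OF C1 that] by (simp add: F_def[abs_def])
  have Fc: "continuous_on {0..b} F" using C1_potential_cont[OF C1, of b] by (simp add: F_def[abs_def])
  have F0: "F 0 = 0" by (simp add: F_def)
  define \<phi> where "\<phi> v = sqrt (- 2 * F v / d)" for v
  have Fneg: "F v < 0" if "0 < v" "v < b" for v using neg that by (simp add: F_def)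
  obtain k where k: "k > 0" "\<And>s r. s \<in> {0..b} \<Longrightarrow> r \<in> {0..b} \<Longrightarrow> \<bar>f s - f r\<bar> \<le> k * \<bar>s - r\<bar>"
    using C1_lipschitz[OF C1, of 0 b] by blast
  define C where "C = sqrt (k / d)"
  have C: "0 < C" "C\<^sup>2 = k / d" using k d by (auto simp: C_def)
  have pos: "0 < \<phi> v" if "0 < v" "v < b" for v
    using Fneg[OF that] d by (simp add: \<phi>_def divide_neg_pos)
  have \<phi>': "(\<phi> has_real_derivative - f v / (d * \<phi> v)) (at v)" if "0 < v" "v < b" for v
  proof -
    have "0 < - 2 * F v / d" using Fneg[OF that] d by (simp add: divide_neg_pos)
    then have "(\<phi> has_real_derivative (- 2 * f v / d) * (inverse (sqrt (- 2 * F v / d)) / 2)) (at v)"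
      unfolding \<phi>_def by (auto intro!: derivative_eq_intros F' that)
    then show ?thesis by (simp add: \<phi>_def field_simps)
  qed
  have lin: "\<phi> v \<le> C * v" if "0 < v" "v < b" for v
  proof -
    have "F 0 + k * 0\<^sup>2 / 2 \<le> F v + k * v\<^sup>2 / 2"
    proof (rule DERIV_nonneg_imp_increasing_open[where f="\<lambda>v. F v + k * v\<^sup>2 / 2"])
      fix x assume "0 < x" "x < v"
      then have "\<bar>f x\<bar> \<le> k * x" using k(2)[of x 0] f0 that by auto
      then show "\<exists>y. ((\<lambda>v. F v + k * v\<^sup>2 / 2) has_real_derivative y) (at x) \<and> 0 \<le> y"
        using F'[OF \<open>0 < x\<close>] by (intro exI[of _ "f x + k * x"]) (auto intro!: derivative_eq_intros)
    next
      show "continuous_on {0..v} (\<lambda>v. F v + k * v\<^sup>2 / 2)"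
        using that by (intro continuous_intros continuous_on_subset[OF Fc]) auto
    qed (use that in auto)
    then have "- 2 * F v / d \<le> k * v\<^sup>2 / d" using F0 d by (intro divide_right_mono) auto
    also have "\<dots> = C\<^sup>2 * v\<^sup>2" using C by simp
    also have "\<dots> = (C * v)\<^sup>2" by (simp add: power_mult_distrib)
    finally show ?thesis unfolding \<phi>_def using C that by (intro real_le_lsqrt) auto
  qed
  have lin2: "\<phi> v \<le> C * (b - v)" if fb: "f b = 0" "integral {0..b} f = 0" and v: "0 < v" "v < b" for v
  proof -
    have "F b + k * (b - b)\<^sup>2 / 2 \<le> F v + k * (b - v)\<^sup>2 / 2"
    proof (rule DERIV_nonpos_imp_decreasing_open[where f="\<lambda>v. F v + k * (b - v)\<^sup>2 / 2"])
      fix x assume x: "v < x" "x < b"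
      then have "\<bar>f x\<bar> \<le> k * (b - x)" using k(2)[of x b] fb v by auto
      then show "\<exists>y. ((\<lambda>v. F v + k * (b - v)\<^sup>2 / 2) has_real_derivative y) (at x) \<and> y \<le> 0"
        using F'[of x] x v by (intro exI[of _ "f x - k * (b - x)"])
          (auto intro!: derivative_eq_intros, simp add: field_simps)
    next
      show "continuous_on {v..b} (\<lambda>v. F v + k * (b - v)\<^sup>2 / 2)"
        using v by (intro continuous_intros continuous_on_subset[OF Fc]) auto
    qed (use v in auto)
    then have "- 2 * F v / d \<le> k * (b - v)\<^sup>2 / d"
      using fb(2) d by (intro divide_right_mono) (auto simp: F_def)
    also have "\<dots> = C\<^sup>2 * (b - v)\<^sup>2" using C by simp
    also have "\<dots> = (C * (b - v))\<^sup>2" by (simp add: power_mult_distrib)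
    finally show ?thesis unfolding \<phi>_def using C v by (intro real_le_lsqrt) auto
  qed
  have cont: "isCont \<phi> v" if "0 < v" "v < b" for v using \<phi>'[OF that] by (rule DERIV_isCont)
  show ?thesis
  proof (rule decreasing_solution_autonomous_ode[OF b C(1) pos cont lin])
    fix V J
    assume VJ: "open J" "\<And>x y. x \<in> J \<Longrightarrow> x \<le> y \<Longrightarrow> y \<in> J"
      "\<And>x. x \<in> J \<Longrightarrow> 0 < V x \<and> V x < b \<and> (V has_real_derivative - \<phi> (V x)) (at x)"
      "\<And>v. 0 < v \<Longrightarrow> v < b \<Longrightarrow> \<exists>x\<in>J. V x = v"
      "\<And>x y. x \<in> J \<Longrightarrow> x < y \<Longrightarrow> V y < V x"
      "(V \<longlongrightarrow> 0) at_top"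
      "(\<And>v. 0 < v \<Longrightarrow> v < b \<Longrightarrow> \<phi> v \<le> C * (b - v)) \<Longrightarrow> J = UNIV \<and> (V \<longlongrightarrow> b) at_bot"
    show thesis
  proof (rule that[of J \<phi> V])
    show "((\<lambda>y. - \<phi> (V y)) has_real_derivative - f (V x) / d) (at x)" if x: "x \<in> J" for x
    proof -
      note Vx = VJ(3)[OF x]
      have "((\<lambda>y. \<phi> (V y)) has_real_derivative (- f (V x) / (d * \<phi> (V x))) * (- \<phi> (V x))) (at x)"
        using Vx \<phi>' by (intro DERIV_chain2[where f=\<phi>]) auto
      from DERIV_minus[OF this] show ?thesis using pos[of "V x"] Vx d by simp
    qed
    show "continuous_on {0<..<b} \<phi>" using cont by (auto intro!: continuous_at_imp_continuous_on)
    show "J = UNIV \<and> (V \<longlongrightarrow> b) at_bot" if "f b = 0" "integral {0..b} f = 0"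
      using VJ(7) lin2[OF that] by simp
    show "0 < V x \<and> V x < b" if "x \<in> J" for x using VJ(3)[OF that] by simp
    show "(V has_real_derivative - \<phi> (V x)) (at x)" if "x \<in> J" for x using VJ(3)[OF that] by simp
  qed (fact VJ pos)+
  qed
qed

section \<open>Barriers and decay in patch 2\<close>

lemma solution_P_nonneg: "solution_P d1 d2 \<sigma> f1 f2 u0 u \<Longrightarrow> 0 \<le> t \<Longrightarrow> 0 \<le> u t x"
  by (simp add: solution_P_def)

lemma solution_P_initial: "solution_P d1 d2 \<sigma> f1 f2 u0 u \<Longrightarrow> u 0 x = u0 x"
  by (simp add: solution_P_def classical_solution_def)

lemma admissible_datum_support:
  assumes "admissible_datum u0"
  obtains L where "0 < L" "\<And>x. L \<le> \<bar>x\<bar> \<Longrightarrow> u0 x = 0"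
proof -
  have "bounded (closure {x. u0 x \<noteq> 0})"
    using assms unfolding admissible_datum_def by (intro compact_imp_bounded) simp
  then obtain a where a: "\<forall>x \<in> closure {x. u0 x \<noteq> 0}. norm x \<le> a"
    unfolding bounded_iff by (rule exE)
  have "u0 x = 0" if "\<bar>a\<bar> + 1 \<le> \<bar>x\<bar>" for x
  proof (rule ccontr)
    assume "u0 x \<noteq> 0"
    then have "x \<in> closure {x. u0 x \<noteq> 0}" by (intro subsetD[OF closure_subset]) simp
    with a that show False by fastforce
  qed
  then show ?thesis by (intro that[of "\<bar>a\<bar> + 1"]) auto
qed

lemma admissible_datum_attains_max:
  assumes "admissible_datum u0"
  obtains y where "\<And>x. u0 x \<le> u0 y"
proof -
  obtain L where L: "0 < L" "\<And>x. L \<le> \<bar>x\<bar> \<Longrightarrow> u0 x = 0"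
    using admissible_datum_support[OF assms] by blast
  have "continuous_on {-L..L} u0"
    using assms continuous_on_subset unfolding admissible_datum_def by blast
  then obtain y where y: "\<forall>x\<in>{-L..L}. u0 x \<le> u0 y"
    using continuous_attains_sup[of "{-L..L}" u0] L(1) by auto
  have "u0 x \<le> u0 y" for x
  proof (cases "\<bar>x\<bar> \<le> L")
    case True then show ?thesis using y by (simp add: abs_le_iff)
  next
    case False
    then show ?thesis using L(2)[of x] assms by (simp add: admissible_datum_def)
  qed
  then show ?thesis by (rule that)
qed

lemma blocked_in_patch2I:
  assumes "\<And>t x. 0 \<le> t \<Longrightarrow> 0 \<le> u t x"
    and "\<And>e. 0 < e \<Longrightarrow> \<exists>X. \<forall>x\<ge>X. \<forall>t\<ge>0. u t x < e"
  shows "blocked_in_patch2 u"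
  unfolding blocked_in_patch2_def uniform_limit_iff
proof (intro allI impI)
  fix e :: real assume "0 < e"
  then obtain X where "\<forall>x\<ge>X. \<forall>t\<ge>0. u t x < e" using assms(2) by blast
  then have "\<forall>t\<in>{0..}. dist (u t x) 0 < e" if "X \<le> x" for x using that assms(1) by simp
  then show "\<forall>\<^sub>F x in at_top. \<forall>t\<in>{0..}. dist (u t x) 0 < e"
    by (rule eventually_mono[OF eventually_ge_at_top[of X]])
qed

lemma bounded_by_constant_supersolution:
  assumes sol: "solution_P d1 d2 \<sigma> f1 f2 u0 u"
    and C1: "f1 C1_differentiable_on UNIV" "f2 C1_differentiable_on UNIV"
    and pos: "0 < d1" "0 < d2" "0 < \<sigma>"
    and M: "0 \<le> M" "f1 M \<le> 0" "f2 M \<le> 0" "\<And>x. u0 x \<le> M" and "0 \<le> t"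
  shows "u t x \<le> M"
proof (rule comparison_principle[OF sol C1 pos order_refl, where W="\<lambda>_ _. M"])
  show "supersol_at d1 f1 (\<lambda>_ _. M) t x" "supersol_at d2 f2 (\<lambda>_ _. M) t x" for t x
    unfolding supersol_at_def using M
    by (auto intro!: exI[of _ 0] exI[of _ "\<lambda>_. 0"])
  show "\<exists>l r. ((\<lambda>_. M) has_real_derivative l) (at 0 within {..0}) \<and>
         ((\<lambda>_. M) has_real_derivative r) (at 0 within {0..}) \<and> \<sigma> * r \<le> l"
    by (auto intro!: exI[of _ 0])
  show "continuous_on ({0..} \<times> UNIV) (\<lambda>(t::real, x::real). M)"
    by (simp add: case_prod_beta)
qed (use M assms solution_P_initial[OF sol] in auto)

text \<open>The barrier is the constant \<open>M\<close> up to \<open>L\<close> and a stationary profile starting from height \<open>M\<close> beyond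
  \<open>L\<close>. The kink at \<open>L\<close> is harmless, because the solution does not exceed \<open>M\<close>.\<close>

lemma blocked_by_decreasing_profile:
  assumes sol: "solution_P d1 d2 \<sigma> f1 f2 u0 u"
    and C1: "f1 C1_differentiable_on UNIV" "f2 C1_differentiable_on UNIV"
    and pos: "0 < d1" "0 < d2" "0 < \<sigma>"
    and f0: "f2 0 = 0" and M: "0 < M" "M < b"
    and neg: "\<And>v. 0 < v \<Longrightarrow> v < b \<Longrightarrow> integral {0..v} f2 < 0"
    and uM: "\<And>t x. 0 \<le> t \<Longrightarrow> u t x \<le> M"
    and L: "0 < L" "\<And>x. L \<le> x \<Longrightarrow> u0 x = 0"
  shows "blocked_in_patch2 u"
proof -
  have b: "0 < b" using M by simp
  show ?thesis
  proof (rule standing_profile[OF C1(2) pos(2) b f0 neg])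
    fix V J \<phi>
    assume J: "open J" "\<And>x y. x \<in> J \<Longrightarrow> x \<le> y \<Longrightarrow> y \<in> J"
      and \<phi>: "\<And>v. 0 < v \<Longrightarrow> v < b \<Longrightarrow> 0 < \<phi> v"
      and V: "\<And>x. x \<in> J \<Longrightarrow> 0 < V x \<and> V x < b"
      and V': "\<And>x. x \<in> J \<Longrightarrow> (V has_real_derivative - \<phi> (V x)) (at x)"
      and V'': "\<And>x. x \<in> J \<Longrightarrow> ((\<lambda>y. - \<phi> (V y)) has_real_derivative - f2 (V x) / d2) (at x)"
      and surj: "\<And>v. 0 < v \<Longrightarrow> v < b \<Longrightarrow> \<exists>x\<in>J. V x = v"
      and lim: "(V \<longlongrightarrow> 0) at_top"
    obtain c where c: "c \<in> J" "V c = M" using surj[OF M] by blast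
    define W where "W x = (if x \<le> L then M else V (x + (c - L)))" for x
    have inJ: "x + (c - L) \<in> J" if "L \<le> x" for x using J(2)[OF c(1), of "x + (c - L)"] that by simp
    have "continuous_on {L..} (\<lambda>x. V (x + (c - L)))"
    proof (intro DERIV_continuous_on)
      fix x assume "x \<in> {L..}"
      then have "((\<lambda>x. V (x + (c - L))) has_real_derivative - \<phi> (V (x + (c - L)))) (at x)"
        using V'[OF inJ, of x] by (simp add: DERIV_shift)
      then show "((\<lambda>x. V (x + (c - L))) has_real_derivative - \<phi> (V (x + (c - L)))) (at x within {L..})"
        by (rule has_field_derivative_at_within)
    qed
    then have "continuous_on ({..L} \<union> {L..}) W"
      unfolding W_def by (intro continuous_on_If) (auto simp: c)
    moreover have "{..L} \<union> {L..} = UNIV" by auto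
    ultimately have Wc: "continuous_on UNIV W" by simp
    have uW: "u t x \<le> W x" if "0 \<le> t" for t x
    proof (rule comparison_principle[OF sol C1 pos order_refl, where W="\<lambda>_. W"])
      show "continuous_on ({0..} \<times> UNIV) (\<lambda>(t::real, x). W x)"
        unfolding case_prod_beta by (intro continuous_on_compose2[OF Wc]) (auto intro!: continuous_intros)
      show "0 \<le> W x" for x using M V[OF inJ, of x] by (auto simp: W_def)
      show "u 0 x \<le> W x" for x
        using uM[of 0 x] L(2)[of x] V[OF inJ, of x] by (auto simp: W_def solution_P_initial[OF sol])
      show "supersol_at d1 f1 (\<lambda>_. W) t x" if "0 < t" "x < 0" "W x < u t x" for t x
        using that uM[of t x] L by (simp add: W_def)
      show "\<exists>l r. (W has_real_derivative l) (at 0 within {..0}) \<and>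
         (W has_real_derivative r) (at 0 within {0..}) \<and> \<sigma> * r \<le> l" if "0 < t" "W 0 < u t 0" for t
        using that uM[of t 0] L by (simp add: W_def)
      show "supersol_at d2 f2 (\<lambda>_. W) t x" if "0 < t" "0 < x" "W x < u t x" for t x
      proof -
        have x: "L < x" using that uM[of t x] by (auto simp: W_def not_le[symmetric])
        have W1: "(W has_real_derivative - \<phi> (V (y + (c - L)))) (at y)" if "L < y" for y
        proof (rule has_field_derivative_transform_within_open[where S="{L<..}" and f="\<lambda>x. V (x + (c - L))"])
          show "((\<lambda>x. V (x + (c - L))) has_real_derivative - \<phi> (V (y + (c - L)))) (at y)"
            using V'[OF inJ, of y] that by (simp add: DERIV_shift)
        qed (use that in \<open>auto simp: W_def\<close>)
        have "\<forall>\<^sub>F y in nhds x. (W has_real_derivative - \<phi> (V (y + (c - L)))) (at y)"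
          using x by (intro eventually_nhds_in_open[THEN eventually_mono, of "{L<..}"] W1) auto
        moreover have "((\<lambda>y. - \<phi> (V (y + (c - L)))) has_real_derivative - f2 (W x) / d2) (at x)"
          using V''[OF inJ, of x] x by (simp add: W_def DERIV_shift[of "\<lambda>y. - \<phi> (V y)"])
        moreover have "d2 * (- f2 (W x) / d2) + f2 (W x) \<le> 0" using pos by simp
        ultimately show ?thesis unfolding supersol_at_def
          by (intro exI[of _ 0] exI[of _ "\<lambda>y. - \<phi> (V (y + (c - L)))"] exI[of _ "- f2 (W x) / d2"]) auto
      qed
    qed fact
    show ?thesis
    proof (rule blocked_in_patch2I)
      show "0 \<le> u t x" if "0 \<le> t" for t x using solution_P_nonneg[OF sol that] .
      fix e :: real assume "0 < e"
      with lim have "\<forall>\<^sub>F x in at_top. V x < e" by (intro order_tendstoD) auto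
      then obtain X where X: "\<And>x. X \<le> x \<Longrightarrow> V x < e" unfolding eventually_at_top_linorder by blast
      have "u t x < e" if "max (L + 1) (X - (c - L)) \<le> x" "0 \<le> t" for t x
        using uW[OF that(2), of x] X[of "x + (c - L)"] that by (simp add: W_def split: if_splits)
      then show "\<exists>X. \<forall>x\<ge>X. \<forall>t\<ge>0. u t x < e" by blast
    qed
  qed
qed

text \<open>The function \<open>M exp (k t - (x - L))\<close> dominates the solution by hypothesis for \<open>x \<le> L\<close>, and beyond
  \<open>L\<close> it solves the linear equation with reaction term \<open>\<Lambda> u\<close>, which bounds \<open>f2\<close> on \<open>[0, M]\<close>.\<close>

lemma exponential_decay_in_patch2:
  assumes sol: "solution_P d1 d2 \<sigma> f1 f2 u0 u"
    and C1: "f1 C1_differentiable_on UNIV" "f2 C1_differentiable_on UNIV"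
    and pos: "0 < d1" "0 < d2" "0 < \<sigma>"
    and f0: "f2 0 = 0" and M: "0 < M"
    and uM: "\<And>t x. 0 \<le> t \<Longrightarrow> u t x \<le> M"
    and L: "0 < L" "\<And>x. L \<le> x \<Longrightarrow> u0 x = 0"
  shows "\<exists>k>0. \<forall>t\<ge>0. \<forall>x. u t x \<le> M * exp (k * t - (x - L))"
proof -
  obtain \<Lambda> where \<Lambda>: "\<Lambda> > 0" "\<And>s r. s \<in> {0..M} \<Longrightarrow> r \<in> {0..M} \<Longrightarrow> \<bar>f2 s - f2 r\<bar> \<le> \<Lambda> * \<bar>s - r\<bar>"
    using C1_lipschitz[OF C1(2), of 0 M] by blast
  define k where "k = d2 + \<Lambda>"
  define W where "W t x = M * exp (k * t - (x - L))" for t x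
  have k: "0 < k" using pos \<Lambda> by (simp add: k_def)
  have WM: "M \<le> W t x" if "0 \<le> t" "x \<le> L" for t x
  proof -
    have "0 \<le> k * t" using that k by simp
    then have "M * 1 \<le> W t x" unfolding W_def using that M by (intro mult_left_mono) auto
    then show ?thesis by simp
  qed
  have "u t x \<le> W t x" if "0 \<le> t" for t x
  proof (rule comparison_principle[OF sol C1 pos order_refl])
    show "continuous_on ({0..} \<times> UNIV) (\<lambda>(t, x). W t x)"
      unfolding W_def case_prod_beta by (intro continuous_intros)
    show "0 \<le> W t x" for t x using M by (simp add: W_def)
    show "u 0 x \<le> W 0 x" for x
      using uM[of 0 x] WM[of 0 x] L(2)[of x] M
      by (cases "x \<le> L") (force simp: solution_P_initial[OF sol], simp add: solution_P_initial[OF sol] W_def)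
    show "supersol_at d1 f1 W t x" if "0 < t" "x < 0" "W t x < u t x" for t x
      using that uM[of t x] WM[of t x] L by simp
    show "\<exists>l r. (W t has_real_derivative l) (at 0 within {..0}) \<and>
         (W t has_real_derivative r) (at 0 within {0..}) \<and> \<sigma> * r \<le> l" if "0 < t" "W t 0 < u t 0" for t
      using that uM[of t 0] WM[of t 0] L by simp
    show "supersol_at d2 f2 W t x" if "0 < t" "0 < x" "W t x < u t x" for t x
    proof -
      have "0 < W t x" using M by (simp add: W_def)
      moreover have "W t x \<le> M" using that uM[of t x] by simp
      ultimately have "\<bar>f2 (W t x) - f2 0\<bar> \<le> \<Lambda> * \<bar>W t x - 0\<bar>" using M by (intro \<Lambda>(2)) auto
      then have "f2 (W t x) \<le> \<Lambda> * W t x" using f0 \<open>0 < W t x\<close> by simp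
      then have "d2 * W t x + f2 (W t x) \<le> k * W t x" by (simp add: k_def algebra_simps)
      moreover have "((\<lambda>s. W s x) has_real_derivative k * W t x) (at t)"
        unfolding W_def by (auto intro!: derivative_eq_intros)
      moreover have "(W t has_real_derivative - W t y) (at y)" for y
        unfolding W_def by (auto intro!: derivative_eq_intros)
      moreover have "((\<lambda>y. - W t y) has_real_derivative W t x) (at x)"
        unfolding W_def by (auto intro!: derivative_eq_intros)
      ultimately show ?thesis unfolding supersol_at_def
        by (intro exI[of _ "k * W t x"] exI[of _ "\<lambda>y. - W t y"] exI[of _ "W t x"]) auto
    qed
  qed fact
  with k show ?thesis by (intro exI[of _ k]) (auto simp: W_def)
qed

text \<open>By this decay, blocking is a matter of large times only.\<close>

lemma uniform_decay_on_bounded_times: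
  assumes sol: "solution_P d1 d2 \<sigma> f1 f2 u0 u"
    and C1: "f1 C1_differentiable_on UNIV" "f2 C1_differentiable_on UNIV"
    and pos: "0 < d1" "0 < d2" "0 < \<sigma>"
    and f0: "f2 0 = 0" and M: "0 < M"
    and uM: "\<And>t x. 0 \<le> t \<Longrightarrow> u t x \<le> M"
    and L: "0 < L" "\<And>x. L \<le> x \<Longrightarrow> u0 x = 0"
    and e: "0 < e"
  shows "\<exists>X. \<forall>x\<ge>X. \<forall>t. 0 \<le> t \<and> t \<le> S \<longrightarrow> u t x < e"
proof -
  obtain k where k: "0 < k" "\<forall>t\<ge>0. \<forall>x. u t x \<le> M * exp (k * t - (x - L))"
    using exponential_decay_in_patch2[OF sol C1 pos f0 M uM L] by blast
  show ?thesis
  proof (intro exI allI impI)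
    fix x t assume x: "k * S + L + ln (M / e) + 1 \<le> x" and t: "0 \<le> t \<and> t \<le> S"
    have "u t x \<le> M * exp (k * t - (x - L))" using k(2) t by simp
    also have "\<dots> < M * exp (- ln (M / e))"
    proof -
      have "k * t \<le> k * S" using k t by simp
      then have "k * t - (x - L) < - ln (M / e)" using x by linarith
      then show ?thesis using M by simp
    qed
    also have "\<dots> = e" using M e by (simp add: exp_minus)
    finally show "u t x < e" .
  qed
qed

lemma continuous_neg_bound:
  fixes f :: "real \<Rightarrow> real"
  assumes "f C1_differentiable_on UNIV" "\<And>s. a \<le> s \<Longrightarrow> s \<le> b \<Longrightarrow> f s < 0"
  shows "\<exists>c>0. \<forall>s\<in>{a..b}. f s \<le> - c"
proof (cases "a \<le> b")
  case True
  have "continuous_on {a..b} f"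
    using assms(1) by (meson C1_differentiable_imp_continuous_on continuous_on_subset subset_UNIV)
  then obtain y where y: "y \<in> {a..b}" "\<forall>x\<in>{a..b}. f x \<le> f y"
    using continuous_attains_sup[of "{a..b}" f] True by auto
  show ?thesis using y assms(2)[of y] by (intro exI[of _ "- f y"]) auto
next
  case False then show ?thesis by (intro exI[of _ 1]) auto
qed

text \<open>Above \<open>m\<close> both reaction terms are negative, so spatially constant supersolutions relax
  exponentially to \<open>m\<close>.\<close>

lemma eventually_below:
  assumes sol: "solution_P d1 d2 \<sigma> f1 f2 u0 u"
    and C1: "f1 C1_differentiable_on UNIV" "f2 C1_differentiable_on UNIV"
    and pos: "0 < d1" "0 < d2" "0 < \<sigma>"
    and m: "0 \<le> m" and M: "m < M" "\<And>x. u0 x \<le> M"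
    and neg: "\<And>s. m \<le> s \<Longrightarrow> f1 s < 0" "\<And>s. m \<le> s \<Longrightarrow> f2 s < 0"
    and \<eta>: "0 < \<eta>"
  shows "\<exists>T\<ge>0. \<forall>x. u T x \<le> m + \<eta>"
proof -
  obtain c1 where c1: "0 < c1" "\<forall>s\<in>{m..M}. f1 s \<le> - c1"
    using continuous_neg_bound[OF C1(1), of m M] neg(1) by blast
  obtain c2 where c2: "0 < c2" "\<forall>s\<in>{m..M}. f2 s \<le> - c2"
    using continuous_neg_bound[OF C1(2), of m M] neg(2) by blast
  define c where "c = min c1 c2"
  define Q where "Q = M - m"
  define \<delta> where "\<delta> = c / Q"
  have Q: "0 < Q" and c: "0 < c" using M c1 c2 by (auto simp: Q_def c_def)
  then have \<delta>: "0 < \<delta>" "\<delta> * Q = c" by (auto simp: \<delta>_def)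
  define w where "w t = m + Q * exp (- \<delta> * t)" for t
  have w: "m \<le> w t" "w t \<le> M" if "0 \<le> t" for t
  proof -
    have "Q * exp (- \<delta> * t) \<le> Q * 1" using Q \<delta> that by (intro mult_left_mono) auto
    then show "w t \<le> M" by (simp add: w_def Q_def)
    show "m \<le> w t" using Q by (simp add: w_def)
  qed
  have ww: "- c \<le> - (\<delta> * Q * exp (- \<delta> * t))" if "0 \<le> t" for t
  proof -
    have "c * exp (- \<delta> * t) \<le> c * 1" using c \<delta> that by (intro mult_left_mono) auto
    then show ?thesis using \<delta> by simp
  qed
  have der: "(w has_real_derivative - (\<delta> * Q * exp (- \<delta> * t))) (at t)" for t
    unfolding w_def by (auto intro!: derivative_eq_intros)
  have uw: "u t x \<le> w t" if "0 \<le> t" for t x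
  proof (rule comparison_principle[OF sol C1 pos order_refl, where W="\<lambda>t _. w t"])
    show "continuous_on ({0..} \<times> UNIV) (\<lambda>(t, x::real). w t)"
      unfolding w_def case_prod_beta by (intro continuous_intros)
    show "0 \<le> w t" if "0 \<le> t" for t using w[OF that] m by simp
    show "u 0 x \<le> w 0" for x using M by (simp add: w_def Q_def solution_P_initial[OF sol])
    show "supersol_at d1 f1 (\<lambda>t _. w t) t x" if "0 < t" for t x
      unfolding supersol_at_def using der[of t] c1(2)[rule_format, of "w t"] w[of t] ww[of t] that
      by (intro exI[of _ "- (\<delta> * Q * exp (- \<delta> * t))"] exI[of _ 0] exI[of _ "\<lambda>_. 0"]) (auto simp: c_def)
    show "supersol_at d2 f2 (\<lambda>t _. w t) t x" if "0 < t" for t x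
      unfolding supersol_at_def using der[of t] c2(2)[rule_format, of "w t"] w[of t] ww[of t] that
      by (intro exI[of _ "- (\<delta> * Q * exp (- \<delta> * t))"] exI[of _ 0] exI[of _ "\<lambda>_. 0"]) (auto simp: c_def)
    show "\<exists>l r. ((\<lambda>_. w t) has_real_derivative l) (at 0 within {..0}) \<and>
         ((\<lambda>_. w t) has_real_derivative r) (at 0 within {0..}) \<and> \<sigma> * r \<le> l" for t
      by (auto intro!: exI[of _ 0])
  qed fact
  define T where "T = max 0 (ln (Q / \<eta>) / \<delta>)"
  have "ln (Q / \<eta>) \<le> \<delta> * T" using \<delta> by (simp add: T_def max_def field_simps)
  then have "exp (ln (Q / \<eta>)) \<le> exp (\<delta> * T)" by simp
  then have "Q / \<eta> \<le> exp (\<delta> * T)" using Q \<eta> by simp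
  then have "Q * exp (- \<delta> * T) \<le> \<eta>" using \<eta> by (simp add: exp_minus field_simps)
  then have "u T x \<le> m + \<eta>" for x using uw[of T x] by (simp add: w_def T_def)
  then show ?thesis by (intro exI[of _ T]) (auto simp: T_def)
qed

section \<open>Blocking for bistable nonlinearities\<close>

lemma bistableD:
  assumes "bistable f \<theta> K"
  shows "0 < \<theta>" "\<theta> < K" "f 0 = 0" "f \<theta> = 0" "f K = 0" "deriv f 0 < 0" "deriv f K < 0"
    "\<And>s. 0 < s \<Longrightarrow> s < \<theta> \<Longrightarrow> f s < 0" "\<And>s. K < s \<Longrightarrow> f s < 0"
    "\<And>s. \<theta> < s \<Longrightarrow> s < K \<Longrightarrow> 0 < f s"
  using assms by (auto simp: bistable_def)

text \<open>The primitive of a bistable nonlinearity decreases on \<open>[0, \<theta>]\<close>, increases on \<open>[\<theta>, K]\<close> and decreases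
  again on \<open>[K, \<infinity>)\<close>; its sign is thus governed by its value at the local maximum \<open>K\<close>.\<close>

lemma bistable_potential:
  assumes C1: "f C1_differentiable_on UNIV" and bi: "bistable f \<theta> K"
  shows "0 < v \<Longrightarrow> v \<le> \<theta> \<Longrightarrow> integral {0..v} f < 0"
    and "integral {0..K} f < 0 \<Longrightarrow> 0 < v \<Longrightarrow> integral {0..v} f < 0"
    and "integral {0..K} f = 0 \<Longrightarrow> 0 < v \<Longrightarrow> v < K \<Longrightarrow> integral {0..v} f < 0"
proof -
  define F where "F v = integral {0..v} f" for v
  note b = bistableD[OF bi]
  have F': "(F has_real_derivative f v) (at v)" if "0 < v" for v
    using C1_potential_derivative[OF C1 that] by (simp add: F_def[abs_def])
  have Fc: "continuous_on {a..c} F" if "0 \<le> a" for a c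
    by (rule continuous_on_subset[of "{0..c}"])
       (use C1_potential_cont[OF C1, of c] that in \<open>auto simp: F_def[abs_def]\<close>)
  have F0: "F 0 = 0" by (simp add: F_def)
  have 1: "F v < 0" if "0 < v" "v \<le> \<theta>" for v
  proof -
    have "F v < F 0"
    proof (rule DERIV_neg_imp_decreasing_open[OF that(1)])
      fix x assume "0 < x" "x < v"
      then show "\<exists>y. (F has_real_derivative y) (at x) \<and> y < 0"
        using F'[of x] b(8)[of x] that by (intro exI[of _ "f x"]) auto
    qed (rule Fc, simp)
    then show ?thesis using F0 by simp
  qed
  have 2: "F v < F K" if "\<theta> \<le> v" "v < K" for v
  proof (rule DERIV_pos_imp_increasing_open[OF that(2)])
    fix x assume "v < x" "x < K"
    then show "\<exists>y. (F has_real_derivative y) (at x) \<and> 0 < y"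
      using F'[of x] b(1) b(10)[of x] that by (intro exI[of _ "f x"]) auto
  qed (rule Fc, use b(1) that in simp)
  have 3: "F v < F K" if "K < v" for v
  proof (rule DERIV_neg_imp_decreasing_open[OF that])
    fix x assume "K < x" "x < v"
    then show "\<exists>y. (F has_real_derivative y) (at x) \<and> y < 0"
      using F'[of x] b(1,2) b(9)[of x] that by (intro exI[of _ "f x"]) auto
  qed (rule Fc, use b(1,2) in simp)
  show "0 < v \<Longrightarrow> v \<le> \<theta> \<Longrightarrow> integral {0..v} f < 0" using 1[of v] by (simp add: F_def)
  show "integral {0..v} f < 0" if "integral {0..K} f < 0" "0 < v"
    using 1[of v] 2[of v] 3[of v] that
    by (cases "v \<le> \<theta>"; cases v K rule: linorder_cases) (auto simp: F_def)
  show "integral {0..v} f < 0" if "integral {0..K} f = 0" "0 < v" "v < K"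
    using 1[of v] 2[of v] that by (cases "v \<le> \<theta>") (auto simp: F_def)
qed

text \<open>Near a stable zero, a small upward shift \<open>q\<close> lowers the reaction by at least \<open>\<mu> q\<close>. This pays for the decay of the
  additive correction in the supersolution of the next lemma.\<close>

lemma stable_zero_dissipation:
  fixes f :: "real \<Rightarrow> real"
  assumes C1: "f C1_differentiable_on UNIV" and neg: "deriv f p < 0"
  shows "\<exists>\<delta>>0. \<exists>\<mu>>0. \<forall>s q. \<bar>s - p\<bar> \<le> \<delta> \<longrightarrow> 0 \<le> q \<longrightarrow> q \<le> \<delta> \<longrightarrow>
    f (s + q) \<le> f s - \<mu> * q"
proof -
  obtain f' where f': "\<And>s. (f has_real_derivative f' s) (at s)" "continuous_on UNIV f'"
    using C1_differentiable_on_UNIV_real[OF C1] by blast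
  have fp: "f' p < 0" using neg DERIV_imp_deriv[OF f'(1)[of p]] by simp
  have "isCont f' p" using f'(2) by (simp add: continuous_on_eq_continuous_at)
  then have "(f' \<longlongrightarrow> f' p) (nhds p)" by (simp add: continuous_at tendsto_nhds_iff)
  then have "\<forall>\<^sub>F s in nhds p. f' s < f' p / 2" using fp by (intro order_tendstoD) auto
  then obtain d where d: "0 < d" "\<And>s. dist s p < d \<Longrightarrow> f' s < f' p / 2"
    unfolding eventually_nhds_metric by blast
  have main: "f (s + q) \<le> f s - (- f' p / 2) * q" if "\<bar>s - p\<bar> \<le> d/3" "0 \<le> q" "q \<le> d/3" for s q
  proof -
    have "f (s + q) - (f' p / 2) * (s + q) \<le> f s - (f' p / 2) * s"
    proof (rule DERIV_nonpos_imp_nonincreasing[where f="\<lambda>x. f x - (f' p / 2) * x"])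
      fix x assume x: "s \<le> x" "x \<le> s + q"
      have "s - p \<le> d/3" "p - s \<le> d/3" using that by linarith+
      then have "dist x p < d" unfolding dist_real_def abs_less_iff using x that d by linarith
      from d(2)[OF this] show "\<exists>y. ((\<lambda>x. f x - (f' p / 2) * x) has_real_derivative y) (at x) \<and> y \<le> 0"
        by (intro exI[of _ "f' x - f' p / 2"]) (auto intro!: derivative_eq_intros f'(1))
    qed (use that in simp)
    then show ?thesis by (simp add: field_simps)
  qed
  show ?thesis using d fp main by (intro exI[of _ "d/3"] exI[of _ "- f' p / 2"] conjI) auto
qed

text \<open>No stationary profile comes down to \<open>0\<close> from above \<open>K2\<close> here, since the primitive of \<open>f2\<close> vanishes
  at \<open>K2\<close>. After some
  time, however, the solution is at most \<open>K2 + \<delta> / 2\<close>, and from then on a supersolution of Fife--McLeod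
  type is available: \<open>V(x - a(t)) + q(t)\<close>, where \<open>V\<close> is the standing wave of patch 2, the excess \<open>q\<close>
  decays exponentially, and the shift \<open>a\<close> increases by a finite amount in total. Where \<open>V\<close> is close
  to \<open>0\<close> or \<open>K2\<close>, stability of these states compensates \<open>q'\<close>; in between, \<open>V\<close> is strictly decreasing
  and the motion of the shift does. In patch 1 the supersolution is extended by its value at the interface:
  that value lies above \<open>K1\<close>, where \<open>f1\<close> is negative, and the flux condition holds because the extension
  is flat while \<open>V\<close> decreases.\<close>

lemma blocked_if_balanced:
  assumes sol: "solution_P d1 d2 \<sigma> f1 f2 u0 u"
    and C1: "f1 C1_differentiable_on UNIV" "f2 C1_differentiable_on UNIV"
    and pos: "0 < d1" "0 < d2" "0 < \<sigma>"
    and bi1: "bistable f1 \<theta>1 K1" and bi2: "bistable f2 \<theta>2 K2"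
    and bal: "integral {0..K2} f2 = 0" and K: "K1 < K2"
    and adm: "admissible_datum u0"
  shows "blocked_in_patch2 u"
proof -
  note b1 = bistableD[OF bi1] and b2 = bistableD[OF bi2]
  have K2: "0 < K2" and K1: "0 < K1" using b1 b2 by auto
  obtain L where L: "0 < L" "\<And>x. L \<le> x \<Longrightarrow> u0 x = 0"
    using admissible_datum_support[OF adm] by (metis abs_ge_self order_trans)
  obtain y0 where y0: "\<And>x. u0 x \<le> u0 y0" using admissible_datum_attains_max[OF adm] by blast
  obtain \<delta>0 \<mu>0 where \<delta>0: "0 < \<delta>0" "0 < \<mu>0"
    "\<forall>s q. \<bar>s - 0\<bar> \<le> \<delta>0 \<longrightarrow> 0 \<le> q \<longrightarrow> q \<le> \<delta>0 \<longrightarrow> f2 (s + q) \<le> f2 s - \<mu>0 * q"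
    using stable_zero_dissipation[OF C1(2) b2(6)] by blast
  obtain \<delta>K \<mu>K where \<delta>K: "0 < \<delta>K" "0 < \<mu>K"
    "\<forall>s q. \<bar>s - K2\<bar> \<le> \<delta>K \<longrightarrow> 0 \<le> q \<longrightarrow> q \<le> \<delta>K \<longrightarrow> f2 (s + q) \<le> f2 s - \<mu>K * q"
    using stable_zero_dissipation[OF C1(2) b2(7)] by blast
  define \<delta> where "\<delta> = min (min \<delta>0 \<delta>K) (K2 / 3)"
  have \<delta>: "0 < \<delta>" "\<delta> \<le> \<delta>0" "\<delta> \<le> \<delta>K" "\<delta> \<le> K2 / 3" using \<delta>0 \<delta>K K2 by (auto simp: \<delta>_def)
  define Km where "Km = (K1 + K2) / 2"
  have Km: "K1 < Km" "Km < K2" using K by (auto simp: Km_def)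
  have "\<exists>c>0. \<forall>s\<in>{Km..K2 + \<delta>}. f1 s \<le> - c"
    by (rule continuous_neg_bound[OF C1(1)]) (use b1(9) Km in auto)
  then obtain c where c: "0 < c" "\<forall>s\<in>{Km..K2 + \<delta>}. f1 s \<le> - c" by blast
  \<comment> \<open>The rate must not exceed \<open>c / \<delta>\<close> for the spatially constant extension to be a supersolution in
    patch 1.\<close>
  define \<mu> where "\<mu> = min (min \<mu>0 \<mu>K) (c / \<delta>)"
  have \<mu>: "0 < \<mu>" "\<mu> \<le> \<mu>0" "\<mu> \<le> \<mu>K" "\<mu> \<le> c / \<delta>" using \<delta>0 \<delta>K c \<delta> by (auto simp: \<mu>_def)
  have \<mu>c: "\<mu> * \<delta> \<le> c" using \<mu>(4) \<delta> by (simp add: field_simps)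
  obtain \<Lambda> where \<Lambda>: "\<Lambda> > 0" "\<forall>s\<in>{0..K2 + \<delta>}. \<forall>r\<in>{0..K2 + \<delta>}. \<bar>f2 s - f2 r\<bar> \<le> \<Lambda> * \<bar>s - r\<bar>"
    using C1_lipschitz[OF C1(2), of 0 "K2 + \<delta>"] by blast
  define M where "M = max (K2 + \<delta>) (u0 y0) + 1"
  have M: "K2 + \<delta> < M" "\<And>x. u0 x \<le> M" using y0 by (auto simp: M_def intro: order_trans[OF y0])
  have uM: "u t x \<le> M" if "0 \<le> t" for t x
    using bounded_by_constant_supersolution[OF sol C1 pos _ _ _ M(2) that] b1(9)[of M] b2(9)[of M]
      M(1) K K1 \<delta> by simp
  have "\<exists>T\<ge>0. \<forall>x. u T x \<le> (K2 + \<delta> / 4) + \<delta> / 4"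
  proof (rule eventually_below[OF sol C1 pos _ _ M(2)])
    show "f1 s < 0" if "K2 + \<delta> / 4 \<le> s" for s using b1(9)[of s] that K \<delta> by simp
    show "f2 s < 0" if "K2 + \<delta> / 4 \<le> s" for s using b2(9)[of s] that \<delta> by simp
  qed (use K2 \<delta> M(1) in auto)
  then obtain T where T: "0 \<le> T" "\<forall>x. u T x \<le> (K2 + \<delta> / 4) + \<delta> / 4" by blast
  have M0: "0 < M" using M K2 \<delta> by simp
  have tail: "\<exists>X. \<forall>x\<ge>X. \<forall>t. 0 \<le> t \<and> t \<le> S \<longrightarrow> u t x < e" if "0 < e" for e S
    by (rule uniform_decay_on_bounded_times[OF sol C1 pos b2(3) M0 uM L that])
  have neg: "\<And>v. 0 < v \<Longrightarrow> v < K2 \<Longrightarrow> integral {0..v} f2 < 0"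
    by (rule bistable_potential(3)[OF C1(2) bi2 bal])
  show ?thesis
  proof (rule standing_profile[OF C1(2) pos(2) K2 b2(3) neg])
    fix V J \<phi>
    assume \<phi>: "\<And>v. 0 < v \<Longrightarrow> v < K2 \<Longrightarrow> 0 < \<phi> v" "continuous_on {0<..<K2} \<phi>"
      and VJ: "\<And>x. x \<in> J \<Longrightarrow> 0 < V x \<and> V x < K2"
      and V'J: "\<And>x. x \<in> J \<Longrightarrow> (V has_real_derivative - \<phi> (V x)) (at x)"
      and V''J: "\<And>x. x \<in> J \<Longrightarrow> ((\<lambda>y. - \<phi> (V y)) has_real_derivative - f2 (V x) / d2) (at x)"
      and decJ: "\<And>x y. x \<in> J \<Longrightarrow> x < y \<Longrightarrow> V y < V x"
      and lim: "(V \<longlongrightarrow> 0) at_top"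
      and full: "f2 K2 = 0 \<Longrightarrow> integral {0..K2} f2 = 0 \<Longrightarrow> J = UNIV \<and> (V \<longlongrightarrow> K2) at_bot"
    have J: "J = UNIV" and limb: "(V \<longlongrightarrow> K2) at_bot" using full[OF b2(5) bal] by auto
    have V: "0 < V x" "V x < K2" for x using VJ J by auto
    have V': "(V has_real_derivative - \<phi> (V x)) (at x)" for x using V'J J by auto
    have V'': "((\<lambda>y. - \<phi> (V y)) has_real_derivative - f2 (V x) / d2) (at x)" for x using V''J J by auto
    have dec: "V y \<le> V x" if "x \<le> y" for x y using decJ[of x y] J that by (cases "x = y") auto
    have \<phi>V: "0 < \<phi> (V x)" for x using \<phi>(1) V by blast
    have Vc: "continuous_on UNIV V"
      by (rule DERIV_continuous_on[OF V'[THEN has_field_derivative_at_within]])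
    obtain \<beta> where \<beta>: "0 < \<beta>" "\<forall>v\<in>{\<delta>..K2 - \<delta>}. \<beta> \<le> \<phi> v"
    proof -
      have "continuous_on {\<delta>..K2 - \<delta>} \<phi>" by (rule continuous_on_subset[OF \<phi>(2)]) (use \<delta> in auto)
      then obtain y where y: "y \<in> {\<delta>..K2 - \<delta>}" "\<forall>v\<in>{\<delta>..K2 - \<delta>}. \<phi> y \<le> \<phi> v"
        using continuous_attains_inf[of "{\<delta>..K2 - \<delta>}" \<phi>] \<delta> by auto
      then show ?thesis using that[of "\<phi> y"] \<phi>(1)[of y] \<delta> by auto
    qed
    define X0m where "X0m = max (K2 - \<delta> / 2) Km"
    have "X0m < K2" using \<delta> Km by (auto simp: X0m_def)
    then have "\<forall>\<^sub>F x in at_bot. X0m < V x" using limb by (intro order_tendstoD) auto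
    then obtain X0 where X0: "\<forall>x\<le>X0. X0m < V x" unfolding eventually_at_bot_linorder by blast
    obtain R where R: "0 \<le> R" "\<And>x. R \<le> x \<Longrightarrow> u T x \<le> \<delta>"
    proof -
      obtain X where "\<forall>x\<ge>X. \<forall>t. 0 \<le> t \<and> t \<le> T \<longrightarrow> u t x < \<delta>" using tail[OF \<delta>(1), of T] by blast
      then show ?thesis using that[of "max X 0"] T by (simp add: less_imp_le)
    qed
    \<comment> \<open>\<open>A\<close> places the wave so far to the right that it dominates at time \<open>T\<close>. The total shift \<open>B\<close> is
      chosen so that, in the middle range \<open>V \<in> [\<delta>, K2 - \<delta>]\<close>, the gain \<open>\<beta> a'\<close> equals
      the loss \<open>(\<mu> + \<Lambda>) q\<close> exactly.\<close>
    define A where "A = R - X0"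
    define B where "B = (\<mu> + \<Lambda>) * \<delta> / (\<mu> * \<beta>)"
    have B: "0 < B" "\<beta> * (B * \<mu>) = (\<mu> + \<Lambda>) * \<delta>" using \<mu> \<Lambda> \<delta> \<beta> by (auto simp: B_def)
    define E where "E t = exp (- \<mu> * (t - T))" for t
    have E: "0 < E t" for t by (simp add: E_def)
    have E1: "E t \<le> 1" if "T \<le> t" for t using that \<mu> by (simp add: E_def)
    have E': "(E has_real_derivative - (\<mu> * E t)) (at t)" for t
      unfolding E_def by (auto intro!: derivative_eq_intros)
    have Ec: "continuous_on S E" for S unfolding E_def by (intro continuous_intros)
    define a where "a t = A + B * (1 - E t)" for t
    have a: "A \<le> a t" "a t \<le> A + B" if "T \<le> t" for t
    proof -
      have "0 \<le> B * (1 - E t)" "0 \<le> B * E t" using B E1[OF that] E[of t] by auto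
      then show "A \<le> a t" "a t \<le> A + B" by (auto simp: a_def algebra_simps)
    qed
    define W where "W t x = V (max x 0 - a t) + \<delta> * E t" for t x
    have Wt: "((\<lambda>s. W s x) has_real_derivative
        \<phi> (V (max x 0 - a t)) * (B * (\<mu> * E t)) - \<mu> * (\<delta> * E t)) (at t)" for t x
      unfolding W_def a_def
      by (auto intro!: derivative_eq_intros DERIV_chain2[OF V'] E')
    have low: "Km < V (- a t)" if "T \<le> t" for t
    proof -
      have "X0m < V X0" using X0 by simp
      also have "V X0 \<le> V (- a t)" using a[OF that] R by (intro dec) (auto simp: A_def)
      finally show ?thesis by (simp add: X0m_def)
    qed
    have uW: "u t x \<le> W t x" if "T \<le> t" for t x
    proof (rule comparison_principle[OF sol C1 pos T(1)])
      show "continuous_on ({T..} \<times> UNIV) (\<lambda>(t, x). W t x)"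
        unfolding W_def a_def case_prod_beta
        by (intro continuous_intros continuous_on_compose2[OF Vc] continuous_on_compose2[OF Ec[of UNIV]]) auto
      show "0 \<le> W t x" for t x using V(1)[of "max x 0 - a t"] E[of t] \<delta> by (simp add: W_def add_nonneg_nonneg)
      show "u T x \<le> W T x" for x
      proof (cases "R \<le> x")
        case True
        then show ?thesis using R(2)[OF True] V(1)[of "max x 0 - a T"] by (simp add: W_def E_def)
      next
        case False
        have "K2 - \<delta> / 2 \<le> X0m" by (simp add: X0m_def)
        also have "X0m < V X0" using X0 by simp
        also have "V X0 \<le> V (max x 0 - a T)"
          using False R by (intro dec) (auto simp: a_def E_def A_def)
        finally show ?thesis using T(2)[rule_format, of x] by (simp add: W_def E_def)
      qed
      show "supersol_at d1 f1 W t x" if t: "T < t" and x: "x < 0" for t x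
      proof -
        have W1: "(W t has_real_derivative 0) (at y)" if "y < 0" for y
          by (rule has_field_derivative_transform_within_open[where S="{..<0}" and f="\<lambda>_. V (- a t) + \<delta> * E t"])
             (use that in \<open>auto simp: W_def max_def\<close>)
        have "\<forall>\<^sub>F y in nhds x. (W t has_real_derivative 0) (at y)"
          using x by (intro eventually_nhds_in_open[THEN eventually_mono, of "{..<0}"] W1) auto
        moreover have "f1 (W t x) \<le> - c"
        proof -
          have "\<delta> * E t \<le> \<delta>" using E1[of t] t \<delta> by simp
          moreover have "0 < \<delta> * E t" using E[of t] \<delta> by simp
          moreover have "W t x = V (- a t) + \<delta> * E t" using x by (simp add: W_def max_def)
          moreover have "Km < V (- a t)" "V (- a t) < K2" using low[of t] t V(2) by auto
          ultimately have "W t x \<in> {Km..K2 + \<delta>}" unfolding atLeastAtMost_iff by linarith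
          then show ?thesis using c(2) by blast
        qed
        moreover have "\<mu> * (\<delta> * E t) \<le> c"
        proof -
          have "\<mu> * \<delta> * E t \<le> \<mu> * \<delta> * 1" using E1[of t] t \<delta> \<mu> by (intro mult_left_mono) auto
          then show ?thesis using \<mu>c by (simp add: mult.assoc)
        qed
        moreover have "0 \<le> \<phi> (V (max x 0 - a t)) * (B * (\<mu> * E t))"
          using \<phi>V[of "max x 0 - a t"] B(1) \<mu>(1) E[of t] by simp
        ultimately show ?thesis unfolding supersol_at_def using Wt[of x t]
          by (intro exI[of _ "\<phi> (V (max x 0 - a t)) * (B * (\<mu> * E t)) - \<mu> * (\<delta> * E t)"]
                exI[of _ "\<lambda>_. 0"] exI[of _ 0]) auto
      qed
      show "supersol_at d2 f2 W t x" if t: "T < t" and x: "0 < x" for t x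
      proof -
        define v where "v = V (x - a t)"
        define q where "q = \<delta> * E t"
        have v: "0 < v" "v < K2" using V by (auto simp: v_def)
        have q: "0 < q" "q \<le> \<delta>" using E[of t] E1[of t] t \<delta> by (auto simp: q_def)
        have Wtx: "W t x = v + q" using x by (simp add: W_def v_def q_def)
        have W1: "(W t has_real_derivative - \<phi> (V (y - a t))) (at y)" if "0 < y" for y
        proof (rule has_field_derivative_transform_within_open[where S="{0<..}" and f="\<lambda>y. V (y - a t) + \<delta> * E t"])
          show "((\<lambda>y. V (y - a t) + \<delta> * E t) has_real_derivative - \<phi> (V (y - a t))) (at y)"
            by (auto intro!: derivative_eq_intros DERIV_chain2[OF V'])
        qed (use that in \<open>auto simp: W_def max_def\<close>)
        have ev: "\<forall>\<^sub>F y in nhds x. (W t has_real_derivative - \<phi> (V (y - a t))) (at y)"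
          using x by (intro eventually_nhds_in_open[THEN eventually_mono, of "{0<..}"] W1) auto
        have W2: "((\<lambda>y. - \<phi> (V (y - a t))) has_real_derivative - f2 v / d2) (at x)"
          using V''[of "x + - a t"] DERIV_shift[of "\<lambda>y. - \<phi> (V y)" "- f2 v / d2" x "- a t"]
          by (simp add: v_def)
        have \<phi>v: "0 < \<phi> v" using \<phi>V by (simp add: v_def)
        have gain: "0 \<le> \<phi> v * (B * (\<mu> * E t))" using \<phi>v B(1) \<mu>(1) E[of t] by simp
        have "f2 (v + q) - f2 v \<le> \<phi> v * (B * (\<mu> * E t)) - \<mu> * q"
        proof -
          consider "v \<le> \<delta>" | "K2 - \<delta> \<le> v" | "\<delta> \<le> v" "v \<le> K2 - \<delta>" by linarith
          then show ?thesis
          proof cases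
            case 1
            then have "f2 (v + q) \<le> f2 v - \<mu>0 * q" using \<delta>0(3)[rule_format, of v q] v q \<delta> by simp
            moreover have "\<mu> * q \<le> \<mu>0 * q" using \<mu> q by simp
            ultimately show ?thesis using gain by linarith
          next
            case 2
            then have "f2 (v + q) \<le> f2 v - \<mu>K * q" using \<delta>K(3)[rule_format, of v q] v q \<delta> by simp
            moreover have "\<mu> * q \<le> \<mu>K * q" using \<mu> q by simp
            ultimately show ?thesis using gain by linarith
          next
            case 3
            then have "\<beta> \<le> \<phi> v" using \<beta> by simp
            then have "\<beta> * (B * (\<mu> * E t)) \<le> \<phi> v * (B * (\<mu> * E t))"
              using B(1) \<mu>(1) E[of t] by (intro mult_right_mono) auto
            moreover have "\<beta> * (B * (\<mu> * E t)) = \<mu> * q + \<Lambda> * q"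
            proof -
              have "\<beta> * (B * (\<mu> * E t)) = \<beta> * (B * \<mu>) * E t" by simp
              also have "\<dots> = (\<mu> + \<Lambda>) * \<delta> * E t" by (simp only: B(2))
              finally show ?thesis by (simp add: q_def algebra_simps)
            qed
            moreover have "\<bar>f2 (v + q) - f2 v\<bar> \<le> \<Lambda> * \<bar>v + q - v\<bar>"
              using v q by (intro \<Lambda>(2)[rule_format]) auto
            ultimately show ?thesis using q by simp
          qed
        qed
        then have "d2 * (- f2 v / d2) + f2 (W t x) \<le> \<phi> v * (B * (\<mu> * E t)) - \<mu> * (\<delta> * E t)"
          using pos by (simp add: Wtx q_def)
        moreover have "max x 0 = x" using x by simp
        ultimately show ?thesis unfolding supersol_at_def using Wt[of x t] ev W2
          by (intro exI[of _ "\<phi> v * (B * (\<mu> * E t)) - \<mu> * (\<delta> * E t)"]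
                exI[of _ "\<lambda>y. - \<phi> (V (y - a t))"] exI[of _ "- f2 v / d2"]) (auto simp: v_def)
      qed
      show "\<exists>l r. (W t has_real_derivative l) (at 0 within {..0}) \<and>
         (W t has_real_derivative r) (at 0 within {0..}) \<and> \<sigma> * r \<le> l" for t
      proof (intro exI conjI)
        show "(W t has_real_derivative 0) (at 0 within {..0})"
          by (rule has_field_derivative_transform_within[where d=1 and f="\<lambda>_. V (- a t) + \<delta> * E t"])
             (auto simp: W_def max_def)
        have "((\<lambda>y. V (y - a t) + \<delta> * E t) has_real_derivative - \<phi> (V (0 - a t))) (at 0)"
          by (auto intro!: derivative_eq_intros DERIV_chain2[OF V'])
        then have "((\<lambda>y. V (y - a t) + \<delta> * E t) has_real_derivative - \<phi> (V (0 - a t))) (at 0 within {0..})"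
          by (rule has_field_derivative_at_within)
        then show "(W t has_real_derivative - \<phi> (V (0 - a t))) (at 0 within {0..})"
          by (rule has_field_derivative_transform_within[where d=1]) (auto simp: W_def max_def)
        show "\<sigma> * - \<phi> (V (0 - a t)) \<le> 0" using pos \<phi>V[of "0 - a t"] by simp
      qed
    qed fact
    show ?thesis
    proof (rule blocked_in_patch2I)
      show "0 \<le> u t x" if "0 \<le> t" for t x using solution_P_nonneg[OF sol that] .
      fix e :: real assume e: "0 < e"
      define T1 where "T1 = T + max 0 (ln (2 * \<delta> / e) / \<mu>)"
      have late: "\<delta> * E t \<le> e / 2" if "T1 \<le> t" for t
      proof -
        have "ln (2 * \<delta> / e) / \<mu> \<le> t - T" using that by (simp add: T1_def)
        then have "ln (2 * \<delta> / e) \<le> \<mu> * (t - T)" using \<mu> by (simp add: field_simps)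
        then have "E t \<le> exp (- ln (2 * \<delta> / e))" by (simp add: E_def)
        also have "\<dots> = e / (2 * \<delta>)" using e \<delta> by (simp add: exp_minus)
        finally show ?thesis using \<delta> by (simp add: field_simps)
      qed
      have "\<forall>\<^sub>F x in at_top. V x < e / 2" using lim e by (intro order_tendstoD) auto
      then obtain X1 where X1: "\<forall>x\<ge>X1. V x < e / 2" unfolding eventually_at_top_linorder by blast
      obtain X2 where X2: "\<forall>x\<ge>X2. \<forall>t. 0 \<le> t \<and> t \<le> T1 \<longrightarrow> u t x < e" using tail[OF e, of T1] by blast
      have "u t x < e" if x: "max (X1 + A + B) X2 \<le> x" and t: "0 \<le> t" for x t
      proof (cases "t \<le> T1")
        case True then show ?thesis using X2 x t by simp
      next
        case False
        then have tT: "T \<le> t" by (simp add: T1_def)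
        have "V (max x 0 - a t) \<le> V (x - (A + B))" using a[OF tT] by (intro dec) auto
        also have "\<dots> < e / 2" using X1 x by simp
        finally show ?thesis using uW[OF tT, of x] late[of t] False by (simp add: W_def)
      qed
      then show "\<exists>X. \<forall>x\<ge>X. \<forall>t\<ge>0. u t x < e" by blast
    qed
  qed
qed

lemma blocked_if_unbalanced:
  assumes sol: "solution_P d1 d2 \<sigma> f1 f2 u0 u"
    and C1: "f1 C1_differentiable_on UNIV" "f2 C1_differentiable_on UNIV"
    and pos: "0 < d1" "0 < d2" "0 < \<sigma>"
    and bi1: "bistable f1 \<theta>1 K1" and bi2: "bistable f2 \<theta>2 K2"
    and unbal: "integral {0..K2} f2 < 0"
    and adm: "admissible_datum u0"
  shows "blocked_in_patch2 u"
proof -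
  note b1 = bistableD[OF bi1] and b2 = bistableD[OF bi2]
  obtain L where L: "0 < L" "\<And>x. L \<le> x \<Longrightarrow> u0 x = 0"
    using admissible_datum_support[OF adm] by (metis abs_ge_self order_trans)
  obtain y0 where y0: "\<And>x. u0 x \<le> u0 y0" using admissible_datum_attains_max[OF adm] by blast
  define M where "M = max (max K1 K2) (u0 y0) + 1"
  have M: "K1 < M" "K2 < M" "\<And>x. u0 x \<le> M" by (auto simp: M_def intro: order_trans[OF y0])
  then have M0: "0 < M" using b1 by simp
  have uM: "u t x \<le> M" if "0 \<le> t" for t x
    using bounded_by_constant_supersolution[OF sol C1 pos _ _ _ M(3) that] b1(9)[of M] b2(9)[of M] M M0
    by simp
  show ?thesis
    by (rule blocked_by_decreasing_profile[OF sol C1 pos b2(3) M0 _ _ uM L, of "M + 1"])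
       (use bistable_potential(2)[OF C1(2) bi2 unbal] in auto)
qed

lemma blocked_if_below_threshold:
  assumes sol: "solution_P d1 d2 \<sigma> f1 f2 u0 u"
    and C1: "f1 C1_differentiable_on UNIV" "f2 C1_differentiable_on UNIV"
    and pos: "0 < d1" "0 < d2" "0 < \<sigma>"
    and bi1: "bistable f1 \<theta>1 K1" and bi2: "bistable f2 \<theta>2 K2"
    and K: "K1 < \<theta>2" and u0: "\<And>x. u0 x < \<theta>2"
    and adm: "admissible_datum u0"
  shows "blocked_in_patch2 u"
proof -
  note b1 = bistableD[OF bi1] and b2 = bistableD[OF bi2]
  obtain L where L: "0 < L" "\<And>x. L \<le> x \<Longrightarrow> u0 x = 0"
    using admissible_datum_support[OF adm] by (metis abs_ge_self order_trans)
  obtain y0 where y0: "\<And>x. u0 x \<le> u0 y0" using admissible_datum_attains_max[OF adm] by blast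
  have "max K1 (u0 y0) < \<theta>2" using K u0 by simp
  then obtain M where M: "max K1 (u0 y0) < M" "M < \<theta>2" using dense by blast
  then have M0: "0 < M" using b1 by simp
  have u0M: "\<And>x. u0 x \<le> M" using y0 M by (meson le_less_trans less_imp_le max.cobounded2)
  have uM: "u t x \<le> M" if "0 \<le> t" for t x
    using bounded_by_constant_supersolution[OF sol C1 pos _ _ _ u0M that] b1(9)[of M] b2(8)[of M] M M0
    by simp
  show ?thesis
    by (rule blocked_by_decreasing_profile[OF sol C1 pos b2(3) M0 M(2) _ uM L])
       (use bistable_potential(1)[OF C1(2) bi2] in auto)
qed

section \<open>Positivity and decay of stationary solutions\<close>

text \<open>With \<open>p = v' + \<kappa> v\<close> the hypothesis says \<open>p' \<le> \<kappa> p\<close>, so \<open>p exp (- \<kappa> x)\<close> is nonincreasing. Were \<open>p\<close>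
  negative somewhere, it would remain below a negative constant and drive \<open>v\<close> below \<open>0\<close>; hence \<open>p \<ge> 0\<close>,
  which is the lower bound. If \<open>v\<close> starts from \<open>0\<close> with \<open>p \<le> 0\<close>, then \<open>p \<le> 0\<close> throughout, so \<open>v\<close>
  cannot increase. This second part is the form of uniqueness for the Cauchy problem that yields positivity below.\<close>

lemma half_line_lower_bound:
  fixes v v' v'' :: "real \<Rightarrow> real"
  assumes cont: "continuous_on {0..} v" "continuous_on {0..} v'"
    and der: "\<And>x. 0 < x \<Longrightarrow> (v has_real_derivative v' x) (at x)"
      "\<And>x. 0 < x \<Longrightarrow> (v' has_real_derivative v'' x) (at x)"
    and ineq: "\<And>x. 0 < x \<Longrightarrow> v'' x \<le> \<kappa>\<^sup>2 * v x"
    and nonneg: "\<And>x. 0 \<le> x \<Longrightarrow> 0 \<le> v x" and \<kappa>: "0 < \<kappa>"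
  shows "0 \<le> x \<Longrightarrow> v 0 * exp (- \<kappa> * x) \<le> v x"
    and "v 0 = 0 \<Longrightarrow> v' 0 \<le> 0 \<Longrightarrow> 0 \<le> x \<Longrightarrow> v x = 0"
proof -
  define p where "p x = v' x + \<kappa> * v x" for x
  have cs: "continuous_on {a..b} v" "continuous_on {a..b} v'" if "0 \<le> a" for a b
    using that by (auto intro: continuous_on_subset[OF cont(1)] continuous_on_subset[OF cont(2)])
  have mono: "p y * exp (- \<kappa> * y) \<le> p x * exp (- \<kappa> * x)" if "0 \<le> x" "x \<le> y" for x y
  proof (rule DERIV_nonpos_imp_decreasing_open[OF that(2), where f="\<lambda>x. p x * exp (- \<kappa> * x)"])
    fix z assume "x < z" "z < y"
    then have z: "0 < z" using that by simp
    have "((\<lambda>x. p x * exp (- \<kappa> * x)) has_real_derivative (v'' z - \<kappa>\<^sup>2 * v z) * exp (- \<kappa> * z)) (at z)"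
      unfolding p_def by (auto intro!: derivative_eq_intros der z simp: algebra_simps power2_eq_square)
    moreover have "(v'' z - \<kappa>\<^sup>2 * v z) * exp (- \<kappa> * z) \<le> 0"
      using ineq[OF z] by (intro mult_nonpos_nonneg) auto
    ultimately show "\<exists>y. ((\<lambda>x. p x * exp (- \<kappa> * x)) has_real_derivative y) (at z) \<and> y \<le> 0" by blast
  qed (use that in \<open>auto simp: p_def intro!: continuous_intros cs\<close>)
  have p: "0 \<le> p x" if x: "0 \<le> x" for x
  proof (rule ccontr)
    assume "\<not> 0 \<le> p x"
    then have neg: "p x < 0" by simp
    have py: "p y \<le> p x" if "x \<le> y" for y
    proof -
      have "p y * exp (- \<kappa> * y) \<le> p x * exp (- \<kappa> * x)" using mono x that by simp
      also have "\<dots> \<le> p x * exp (- \<kappa> * y)" using neg that \<kappa> by (intro mult_left_mono_neg) auto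
      finally show ?thesis by simp
    qed
    define y where "y = x + (v x + 1) / - p x"
    have "0 < (v x + 1) / - p x" using neg nonneg[OF x] by (intro divide_pos_pos) auto
    then have xy: "x \<le> y" by (simp add: y_def)
    have "v y - p x * y \<le> v x - p x * x"
    proof (rule DERIV_nonpos_imp_decreasing_open[OF xy, where f="\<lambda>z. v z - p x * z"])
      fix z assume z: "x < z" "z < y"
      have "v' z \<le> p z" using nonneg[of z] \<kappa> x z by (simp add: p_def)
      also have "p z \<le> p x" using py z by simp
      finally show "\<exists>y. ((\<lambda>z. v z - p x * z) has_real_derivative y) (at z) \<and> y \<le> 0"
        using x z by (intro exI[of _ "v' z - p x"]) (auto intro!: derivative_eq_intros der)
    qed (use x in \<open>auto intro!: continuous_intros cs\<close>)
    moreover have "p x * (y - x) = - (v x + 1)" using neg by (simp add: y_def)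
    ultimately have "v y \<le> - 1" by (simp add: algebra_simps)
    then show False using nonneg[of y] x xy by simp
  qed
  show "v 0 * exp (- \<kappa> * x) \<le> v x" if x: "0 \<le> x"
  proof -
    have "v 0 * exp (\<kappa> * 0) \<le> v x * exp (\<kappa> * x)"
    proof (rule DERIV_nonneg_imp_increasing_open[OF x, where f="\<lambda>x. v x * exp (\<kappa> * x)"])
      fix z assume z: "0 < z" "z < x"
      have "((\<lambda>x. v x * exp (\<kappa> * x)) has_real_derivative p z * exp (\<kappa> * z)) (at z)"
        unfolding p_def by (auto intro!: derivative_eq_intros der z simp: algebra_simps)
      moreover have "0 \<le> p z * exp (\<kappa> * z)" using p z by simp
      ultimately show "\<exists>y. ((\<lambda>x. v x * exp (\<kappa> * x)) has_real_derivative y) (at z) \<and> 0 \<le> y" by blast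
    qed (auto intro!: continuous_intros cs)
    then show ?thesis by (simp add: exp_minus field_simps)
  qed
  show "v x = 0" if "v 0 = 0" "v' 0 \<le> 0" and x: "0 \<le> x"
  proof -
    have p0: "p z \<le> 0" if "0 \<le> z" for z
    proof -
      have "p z * exp (- \<kappa> * z) \<le> p 0 * exp (- \<kappa> * 0)" using mono[of 0 z] that by simp
      also have "\<dots> \<le> 0" using \<open>v 0 = 0\<close> \<open>v' 0 \<le> 0\<close> by (simp add: p_def)
      finally show ?thesis by (simp add: mult_le_0_iff)
    qed
    have "v x \<le> v 0"
    proof (rule DERIV_nonpos_imp_decreasing_open[OF x])
      fix z assume z: "0 < z" "z < x"
      have "v' z \<le> p z" using nonneg[of z] \<kappa> z by (simp add: p_def)
      then show "\<exists>y. (v has_real_derivative y) (at z) \<and> y \<le> 0"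
        using p0[of z] der(1)[of z] z by (intro exI[of _ "v' z"]) auto
    qed (auto intro!: cs)
    then show ?thesis using nonneg[OF x] \<open>v 0 = 0\<close> by simp
  qed
qed

lemma continuous_with_limits_bounded:
  fixes U :: "real \<Rightarrow> real"
  assumes "continuous_on UNIV U" "(U \<longlongrightarrow> a) at_bot" "(U \<longlongrightarrow> b) at_top"
  shows "\<exists>B. \<forall>x. U x \<le> B"
proof -
  have "\<forall>\<^sub>F x in at_bot. U x < a + 1" "\<forall>\<^sub>F x in at_top. U x < b + 1"
    using assms by (auto intro!: order_tendstoD)
  then obtain X1 X2 where X: "\<forall>x\<le>X1. U x < a + 1" "\<forall>x\<ge>X2. U x < b + 1"
    unfolding eventually_at_bot_linorder eventually_at_top_linorder by blast
  have "compact (U ` {X1..X2})"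
    by (intro compact_continuous_image continuous_on_subset[OF assms(1)]) auto
  then have "bounded (U ` {X1..X2})" by (rule compact_imp_bounded)
  then obtain B where B: "\<forall>y\<in>U ` {X1..X2}. norm y \<le> B" unfolding bounded_iff by (rule exE)
  have "U x \<le> max (max (a + 1) (b + 1)) B" for x
  proof -
    consider "x \<le> X1" | "X2 \<le> x" | "x \<in> {X1..X2}" by fastforce
    then show ?thesis
    proof cases
      case 1 then have "U x < a + 1" using X by simp
      then show ?thesis by simp
    next
      case 2 then have "U x < b + 1" using X by simp
      then show ?thesis by simp
    next
      case 3 then have "\<bar>U x\<bar> \<le> B" using B by auto
      then show ?thesis by simp
    qed
  qed
  then show ?thesis by blast
qed

lemma C2_derivs_interior:
  assumes "C2_derivs J U U' U''" "x \<in> interior J"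
  shows "(U has_real_derivative U' x) (at x)" "(U' has_real_derivative U'' x) (at x)"
proof -
  have "x \<in> J" "at x within J = at x" using assms(2) interior_subset at_within_interior by auto
  then show "(U has_real_derivative U' x) (at x)" "(U' has_real_derivative U'' x) (at x)"
    using assms(1) by (auto simp: C2_derivs_def)
qed

lemma C2_derivs_continuous:
  assumes "C2_derivs J U U' U''"
  shows "continuous_on J U" "continuous_on J U'"
  using assms unfolding C2_derivs_def by (auto intro: DERIV_continuous_on)

text \<open>The reaction terms are Lipschitz on the range of \<open>U\<close>, so \<open>U'' \<le> \<kappa>\<^sup>2 U\<close> on both sides and the
  half-line bounds apply, once \<open>U 0 > 0\<close> is known. If \<open>U 0 = 0\<close>, then \<open>U'(0\<^sup>+) \<ge> 0\<close> by nonnegativity, the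
  flux condition transfers this sign to the left side, and \<open>U\<close> vanishes in patch 1, contrary to its limit.\<close>

lemma stationary_lower_bound:
  assumes stat: "stationary_solution d1 d2 \<sigma> f1 f2 U"
    and C1: "f1 C1_differentiable_on UNIV" "f2 C1_differentiable_on UNIV"
    and pos: "0 < d1" "0 < d2" "0 < \<sigma>" and f0: "f1 0 = 0" "f2 0 = 0"
    and nonneg: "\<And>x. 0 \<le> U x" and K1: "0 < K1"
    and lim: "(U \<longlongrightarrow> K1) at_bot" "(U \<longlongrightarrow> 0) at_top"
  shows "\<exists>c>0. \<exists>\<kappa>>0. (\<forall>x\<le>0. c \<le> U x) \<and> (\<forall>x\<ge>0. c * exp (- \<kappa> * x) \<le> U x)"
proof -
  have contU: "continuous_on UNIV U" using stat by (simp add: stationary_solution_def)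
  from stat obtain U1' U1'' U2' U2'' where
    D1: "C2_derivs {..0} U U1' U1''" and D2: "C2_derivs {0..} U U2' U2''"
    and eq1: "\<And>x. x < 0 \<Longrightarrow> d1 * U1'' x + f1 (U x) = 0"
    and eq2: "\<And>x. 0 < x \<Longrightarrow> d2 * U2'' x + f2 (U x) = 0"
    and fl: "U1' 0 = \<sigma> * U2' 0"
    unfolding stationary_solution_def by blast
  obtain B where B: "\<forall>x. U x \<le> B" using continuous_with_limits_bounded[OF contU lim] by blast
  obtain k1 where k1: "k1 > 0" "\<forall>s\<in>{0..B}. \<forall>r\<in>{0..B}. \<bar>f1 s - f1 r\<bar> \<le> k1 * \<bar>s - r\<bar>"
    using C1_lipschitz[OF C1(1), of 0 B] by blast
  obtain k2 where k2: "k2 > 0" "\<forall>s\<in>{0..B}. \<forall>r\<in>{0..B}. \<bar>f2 s - f2 r\<bar> \<le> k2 * \<bar>s - r\<bar>"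
    using C1_lipschitz[OF C1(2), of 0 B] by blast
  define \<kappa> where "\<kappa> = 1 + k1 / d1 + k2 / d2"
  have kd: "0 < k1 / d1" "0 < k2 / d2" using k1 k2 pos by auto
  then have \<kappa>: "0 < \<kappa>" "1 \<le> \<kappa>" by (auto simp: \<kappa>_def)
  then have "\<kappa> * 1 \<le> \<kappa> * \<kappa>" by (intro mult_left_mono) auto
  then have "\<kappa> \<le> \<kappa>\<^sup>2" by (simp add: power2_eq_square)
  moreover have "k1 / d1 \<le> \<kappa>" "k2 / d2 \<le> \<kappa>" using kd by (auto simp: \<kappa>_def)
  ultimately have kk: "k1 / d1 \<le> \<kappa>\<^sup>2" "k2 / d2 \<le> \<kappa>\<^sup>2" by linarith+
  have "0 \<le> B" using B nonneg order_trans by blast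
  have second: "w \<le> \<kappa>\<^sup>2 * U x"
    if "d * w + f (U x) = 0" "0 < d" "k / d \<le> \<kappa>\<^sup>2" "f 0 = 0"
      "\<forall>s\<in>{0..B}. \<forall>r\<in>{0..B}. \<bar>f s - f r\<bar> \<le> k * \<bar>s - r\<bar>" for d w k x and f :: "real \<Rightarrow> real"
  proof -
    have "\<bar>f (U x) - f 0\<bar> \<le> k * \<bar>U x - 0\<bar>" 
      using B nonneg \<open>0 \<le> B\<close> by (intro that(5)[rule_format]) auto
    then have "d * w \<le> k * U x" using that nonneg[of x] by simp
    then have "w \<le> (k / d) * U x" using \<open>0 < d\<close> by (simp add: field_simps)
    also have "\<dots> \<le> \<kappa>\<^sup>2 * U x" using that nonneg by (intro mult_right_mono) auto
    finally show ?thesis .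
  qed
  have right: "U 0 * exp (- \<kappa> * x) \<le> U x" if "0 \<le> x" for x
  proof (rule half_line_lower_bound(1)[OF C2_derivs_continuous[OF D2] _ _ _ nonneg \<kappa>(1) that])
    fix x :: real assume x: "0 < x"
    show "(U has_real_derivative U2' x) (at x)" "(U2' has_real_derivative U2'' x) (at x)"
      using C2_derivs_interior[OF D2] x by auto
    show "U2'' x \<le> \<kappa>\<^sup>2 * U x" by (rule second[OF eq2[OF x] pos(2) kk(2) f0(2) k2(2)])
  qed
  define v v' v'' where "v x = U (- x)" and "v' x = - U1' (- x)" and "v'' x = U1'' (- x)" for x
  have vc: "continuous_on {0..} v" "continuous_on {0..} v'"
    unfolding v_def v'_def
    by (auto intro!: continuous_intros continuous_on_compose2[OF C2_derivs_continuous(1)[OF D1]]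
          continuous_on_compose2[OF C2_derivs_continuous(2)[OF D1]])
  have vd: "(v has_real_derivative v' x) (at x)" "(v' has_real_derivative v'' x) (at x)"
    if "0 < x" for x
  proof -
    have "(U has_real_derivative U1' (- x)) (at (- x))" "(U1' has_real_derivative U1'' (- x)) (at (- x))"
      using C2_derivs_interior[OF D1, of "- x"] that by auto
    then have "((\<lambda>x. U (- x)) has_real_derivative - U1' (- x)) (at x)"
      "((\<lambda>x. U1' (- x)) has_real_derivative - U1'' (- x)) (at x)"
      by (simp_all only: DERIV_mirror)
    then show "(v has_real_derivative v' x) (at x)" "(v' has_real_derivative v'' x) (at x)"
      unfolding v_def v'_def v''_def by (auto dest: DERIV_minus)
  qed
  have v2: "v'' x \<le> \<kappa>\<^sup>2 * v x" if "0 < x" for x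
    unfolding v_def v''_def
    by (rule second[OF eq1 pos(1) kk(1) f0(1) k1(2)]) (use that in simp)
  have v0: "0 \<le> v x" for x using nonneg by (simp add: v_def)
  have decay: "v 0 * exp (- \<kappa> * x) \<le> v x" if "0 \<le> x" for x
    by (rule half_line_lower_bound(1)[OF vc vd v2 v0 \<kappa>(1) that])
  have vanish: "v x = 0" if "v 0 = 0" "v' 0 \<le> 0" "0 \<le> x" for x
    by (rule half_line_lower_bound(2)[OF vc vd v2 v0 \<kappa>(1) that])
  have U0: "0 < U 0"
  proof (rule ccontr)
    assume "\<not> 0 < U 0"
    then have U0: "U 0 = 0" using nonneg[of 0] by simp
    have D20: "(U has_real_derivative U2' 0) (at 0 within {0..})" using D2 by (simp add: C2_derivs_def)
    have "0 \<le> U2' 0"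
    proof (rule ccontr)
      assume "\<not> 0 \<le> U2' 0"
      then obtain d where d: "d > 0" "\<And>h. 0 < h \<Longrightarrow> 0 + h \<in> {0..} \<Longrightarrow> h < d \<Longrightarrow> U (0 + h) < U 0"
        using has_real_derivative_neg_dec_right[OF D20] by auto
      from d(2)[of "d/2"] d(1) nonneg[of "d/2"] U0 show False by simp
    qed
    then have "v' 0 \<le> 0" using fl pos by (simp add: v'_def)
    then have vz: "v x = 0" if "0 \<le> x" for x using vanish[OF _ _ that] U0 by (simp add: v_def)
    have z: "U x = 0" if "x \<le> 0" for x using vz[of "- x"] that by (simp add: v_def)
    have "\<forall>\<^sub>F x in at_bot. U x = 0"
      by (rule eventually_mono[OF eventually_le_at_bot[of 0]]) (use z in auto)
    moreover have "\<forall>\<^sub>F x in at_bot. 0 < U x" using lim(1) K1 by (intro order_tendstoD) auto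
    ultimately have "\<forall>\<^sub>F x :: real in at_bot. False" by eventually_elim simp
    then show False by simp
  qed
  have left: "U 0 * exp (\<kappa> * x) \<le> U x" if "x \<le> 0" for x
    using decay[of "- x"] that by (simp add: v_def)
  have "\<forall>\<^sub>F x in at_bot. K1 / 2 < U x" using lim(1) K1 by (intro order_tendstoD) auto
  then obtain X where X: "\<forall>x\<le>X. K1 / 2 < U x" unfolding eventually_at_bot_linorder by blast
  define c where "c = min (min (K1 / 2) (U 0)) (U 0 * exp (\<kappa> * X))"
  have c: "0 < c" using K1 U0 by (simp add: c_def)
  have "c \<le> U x" if "x \<le> 0" for x
  proof (cases "x \<le> X")
    case True
    then have "K1 / 2 < U x" using X by simp
    then show ?thesis by (simp add: c_def)
  next
    case False
    have "c \<le> U 0 * exp (\<kappa> * X)" by (simp add: c_def)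
    also have "\<dots> \<le> U 0 * exp (\<kappa> * x)" using False U0 \<kappa> by simp
    also have "\<dots> \<le> U x" using left[OF that] .
    finally show ?thesis .
  qed
  moreover have "c * exp (- \<kappa> * x) \<le> U x" if "0 \<le> x" for x
  proof -
    have "c * exp (- \<kappa> * x) \<le> U 0 * exp (- \<kappa> * x)" by (intro mult_right_mono) (auto simp: c_def)
    with right[OF that] show ?thesis by linarith
  qed
  ultimately show ?thesis using c \<kappa> by blast
qed

section \<open>Smoothing uniformly in the interface parameter\<close>

text \<open>The heat kernel for diffusivity \<open>d\<close>, up to the constant factor \<open>1 / sqrt (4 \<pi> d)\<close>; the prefactor
  \<open>\<tau>\<^sup>-\<^sup>1\<^sup>/\<^sup>2\<close> is absorbed in the exponential.\<close>

definition gauss :: "real \<Rightarrow> real \<Rightarrow> real \<Rightarrow> real" where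
  "gauss d \<tau> z = exp (- ln \<tau> / 2 - z\<^sup>2 / (4 * d * \<tau>))"

lemma gauss_derivs:
  assumes "0 < d" "0 < \<tau>"
  shows "((\<lambda>\<tau>. gauss d \<tau> z) has_real_derivative
      d * ((z\<^sup>2 / (4 * d\<^sup>2 * \<tau>\<^sup>2) - 1 / (2 * d * \<tau>)) * gauss d \<tau> z)) (at \<tau>)"
    and "((\<lambda>z. gauss d \<tau> z) has_real_derivative (- z / (2 * d * \<tau>) * gauss d \<tau> z)) (at z)"
    and "((\<lambda>z. - z / (2 * d * \<tau>) * gauss d \<tau> z) has_real_derivative
      ((z\<^sup>2 / (4 * d\<^sup>2 * \<tau>\<^sup>2) - 1 / (2 * d * \<tau>)) * gauss d \<tau> z)) (at z)"
proof -
  show "((\<lambda>\<tau>. gauss d \<tau> z) has_real_derivative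
      d * ((z\<^sup>2 / (4 * d\<^sup>2 * \<tau>\<^sup>2) - 1 / (2 * d * \<tau>)) * gauss d \<tau> z)) (at \<tau>)"
    unfolding gauss_def using assms
    by (auto intro!: derivative_eq_intros simp: field_simps power2_eq_square)
  show D: "((\<lambda>z. gauss d \<tau> z) has_real_derivative (- z / (2 * d * \<tau>) * gauss d \<tau> z)) (at z)" for z
    unfolding gauss_def using assms
    by (auto intro!: derivative_eq_intros simp: field_simps power2_eq_square)
  show "((\<lambda>z. - z / (2 * d * \<tau>) * gauss d \<tau> z) has_real_derivative
      ((z\<^sup>2 / (4 * d\<^sup>2 * \<tau>\<^sup>2) - 1 / (2 * d * \<tau>)) * gauss d \<tau> z)) (at z)"
    using assms by (auto intro!: derivative_eq_intros D simp: field_simps power2_eq_square)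
qed

text \<open>Rescaling patch 2 by \<open>r = sqrt (d1 / d2)\<close> gives both patches the diffusivity \<open>d1\<close>.\<close>

definition fold_line :: "real \<Rightarrow> real \<Rightarrow> real" where
  "fold_line r x = (if x \<le> 0 then x else r * x)"

lemma fold_line_cont: "continuous_on UNIV (fold_line r)"
proof -
  have "continuous_on ({..0} \<union> {0..}) (\<lambda>x::real. if x \<le> 0 then x else r * x)"
    by (intro continuous_on_If) (auto intro!: continuous_intros)
  moreover have "{..0} \<union> {0::real..} = UNIV" by auto
  ultimately show ?thesis by (simp add: fold_line_def[abs_def])
qed

lemma fold_line_lipschitz:
  assumes "0 < r" shows "\<bar>fold_line r x - fold_line r y\<bar> \<le> max 1 r * \<bar>x - y\<bar>"
proof -
  have *: "\<bar>fold_line r x - fold_line r y\<bar> \<le> max 1 r * \<bar>x - y\<bar>" if "x \<le> y" for x y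
  proof -
    have m: "a \<le> max 1 r * a" "r * a \<le> max 1 r * a" if "0 \<le> a" for a
      using mult_right_mono[of 1 "max 1 r" a] mult_right_mono[of r "max 1 r" a] that by auto
    consider "y \<le> 0" | "x \<le> 0" "0 < y" | "0 < x" by linarith
    then show ?thesis
    proof cases
      case 1 then show ?thesis using that m(1)[of "y - x"] by (simp add: fold_line_def)
    next
      case 2
      have "0 \<le> r * y" using 2 assms by simp
      then have "\<bar>fold_line r x - fold_line r y\<bar> = - x + r * y" using 2 by (simp add: fold_line_def)
      also have "\<dots> \<le> max 1 r * - x + max 1 r * y" using 2 by (intro add_mono m) auto
      also have "\<dots> = max 1 r * \<bar>x - y\<bar>" using 2 by (simp add: algebra_simps)
      finally show ?thesis .
    next
      case 3
      have "\<bar>r * x - r * y\<bar> = r * (y - x)" using that assms by (simp add: abs_if algebra_simps)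
      then show ?thesis using 3 that m(2)[of "y - x"] by (simp add: fold_line_def)
    qed
  qed
  show ?thesis using *[of x y] *[of y x] by (cases "x \<le> y") (auto simp: abs_minus_commute)
qed

text \<open>In the rescaled variable, an \<^emph>\<open>even\<close> solution \<open>H\<close> of the heat equation with diffusivity \<open>d1\<close> has zero
  flux on both sides of the interface. It therefore satisfies the matching condition for every \<open>\<sigma>\<close>
  at once, which is what makes the resulting bounds uniform in \<open>\<sigma>\<close>. The factor \<open>exp (\<Lambda> t)\<close> accounts
  for reaction terms of at most linear growth.\<close>

lemma folded_heat_supersolution:
  assumes sol: "solution_P d1 d2 \<sigma> f1 f2 u0 u"
    and C1: "f1 C1_differentiable_on UNIV" "f2 C1_differentiable_on UNIV"
    and pos: "0 < d1" "0 < d2" "0 < \<sigma>"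
    and lin: "\<And>v. 0 \<le> v \<Longrightarrow> f1 v \<le> \<Lambda> * v" "\<And>v. 0 \<le> v \<Longrightarrow> f2 v \<le> \<Lambda> * v"
    and s: "0 < s"
    and r: "r = sqrt (d1 / d2)"
    and Hc: "continuous_on ({0<..} \<times> UNIV) (\<lambda>(\<tau>, y). H \<tau> y)"
    and H0: "\<And>\<tau> y. 0 < \<tau> \<Longrightarrow> 0 \<le> H \<tau> y"
    and Ht: "\<And>\<tau> y. 0 < \<tau> \<Longrightarrow> ((\<lambda>\<tau>. H \<tau> y) has_real_derivative d1 * Hyy \<tau> y) (at \<tau>)"
    and Hy: "\<And>\<tau> y. 0 < \<tau> \<Longrightarrow> (H \<tau> has_real_derivative Hy \<tau> y) (at y)"
    and Hyy: "\<And>\<tau> y. 0 < \<tau> \<Longrightarrow> (Hy \<tau> has_real_derivative Hyy \<tau> y) (at y)"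
    and even: "\<And>\<tau>. 0 < \<tau> \<Longrightarrow> Hy \<tau> 0 = 0"
    and init: "\<And>x. u0 x \<le> H s (fold_line r x)"
    and t: "0 \<le> t"
  shows "u t x \<le> exp (\<Lambda> * t) * H (t + s) (fold_line r x)"
proof -
  have r0: "0 < r" "d2 * r\<^sup>2 = d1" using pos by (auto simp: r)
  define W where "W t x = exp (\<Lambda> * t) * H (t + s) (fold_line r x)" for t x
  have Wt: "((\<lambda>t. W t x) has_real_derivative
      exp (\<Lambda> * t) * (d1 * Hyy (t + s) (fold_line r x)) + \<Lambda> * W t x) (at t)" if "0 < t" for t x
  proof -
    have "((\<lambda>t. H (t + s) (fold_line r x)) has_real_derivative d1 * Hyy (t + s) (fold_line r x)) (at t)"
      using Ht[of "t + s" "fold_line r x"] that s by (simp add: DERIV_shift[of "\<lambda>\<tau>. H \<tau> (fold_line r x)"])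
    then show ?thesis unfolding W_def by (auto intro!: derivative_eq_intros simp: algebra_simps)
  qed
  have sc1: "((\<lambda>x. F (c * x)) has_real_derivative c * D) (at x)"
    if "(F has_real_derivative D) (at (c * x))" for F :: "real \<Rightarrow> real" and c D x
  proof -
    have "((*) c has_real_derivative c) (at x)" by (auto intro!: derivative_eq_intros)
    from DERIV_chain2[where f=F and g="(*) c", OF that this] show ?thesis by (simp add: mult.commute)
  qed
  have "u t x \<le> W t x"
  proof (rule comparison_principle[OF sol C1 pos order_refl])
    show "continuous_on ({0..} \<times> UNIV) (\<lambda>(t, x). W t x)"
    proof -
      have "continuous_on ({0..} \<times> UNIV) (\<lambda>p :: real \<times> real. (\<lambda>(\<tau>, y). H \<tau> y) (fst p + s, fold_line r (snd p)))"
        by (rule continuous_on_compose2[OF Hc])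
           (use s in \<open>auto intro!: continuous_intros continuous_on_compose2[OF fold_line_cont]\<close>)
      then show ?thesis unfolding W_def case_prod_beta by (auto intro!: continuous_intros)
    qed
    show "0 \<le> W t x" if "0 \<le> t" for t x using H0[of "t + s"] that s by (simp add: W_def)
    show "u 0 x \<le> W 0 x" for x using init[of x] by (simp add: W_def solution_P_initial[OF sol])
    show "supersol_at d1 f1 W t x" if t: "0 < t" and x: "x < 0" for t x
    proof -
      define E where "E = exp (\<Lambda> * t)"
      have ts: "0 < t + s" using t s by simp
      have W1: "(W t has_real_derivative E * Hy (t + s) y) (at y)" if "y < 0" for y
        by (rule has_field_derivative_transform_within_open[where S="{..<0}" and f="\<lambda>y. E * H (t + s) y"])
           (use that ts in \<open>auto intro!: derivative_eq_intros Hy simp: W_def E_def fold_line_def\<close>)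
      have "\<forall>\<^sub>F y in nhds x. (W t has_real_derivative E * Hy (t + s) y) (at y)"
        using x by (intro eventually_nhds_in_open[THEN eventually_mono, of "{..<0}"] W1) auto
      moreover have "((\<lambda>y. E * Hy (t + s) y) has_real_derivative E * Hyy (t + s) x) (at x)"
        by (intro DERIV_cmult Hyy ts)
      moreover have "f1 (W t x) \<le> \<Lambda> * W t x"
        using lin(1) H0[OF ts] by (simp add: W_def)
      moreover have "fold_line r x = x" using x by (simp add: fold_line_def)
      ultimately show ?thesis unfolding supersol_at_def using Wt[OF t, of x]
        by (intro exI[of _ "E * (d1 * Hyy (t + s) x) + \<Lambda> * W t x"]
              exI[of _ "\<lambda>y. E * Hy (t + s) y"] exI[of _ "E * Hyy (t + s) x"]) (auto simp: E_def)
    qed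
    show "supersol_at d2 f2 W t x" if t: "0 < t" and x: "0 < x" for t x
    proof -
      define E where "E = exp (\<Lambda> * t)"
      have ts: "0 < t + s" using t s by simp
      have W1: "(W t has_real_derivative E * (r * Hy (t + s) (r * y))) (at y)" if "0 < y" for y
      proof (rule has_field_derivative_transform_within_open[where S="{0<..}" and f="\<lambda>y. E * H (t + s) (r * y)"])
        show "((\<lambda>y. E * H (t + s) (r * y)) has_real_derivative E * (r * Hy (t + s) (r * y))) (at y)"
          by (intro DERIV_cmult sc1 Hy ts)
      qed (use that in \<open>auto simp: W_def E_def fold_line_def\<close>)
      have "\<forall>\<^sub>F y in nhds x. (W t has_real_derivative E * (r * Hy (t + s) (r * y))) (at y)"
        using x by (intro eventually_nhds_in_open[THEN eventually_mono, of "{0<..}"] W1) auto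
      moreover have "((\<lambda>y. E * (r * Hy (t + s) (r * y))) has_real_derivative
          E * (r * (r * Hyy (t + s) (r * x)))) (at x)"
        by (intro DERIV_cmult sc1 Hyy ts)
      moreover have "f2 (W t x) \<le> \<Lambda> * W t x"
        using lin(2) H0[OF ts] by (simp add: W_def)
      moreover have "fold_line r x = r * x" using x by (simp add: fold_line_def)
      moreover have "d2 * (E * (r * (r * Hyy (t + s) (r * x)))) = E * (d1 * Hyy (t + s) (r * x))"
        using r0(2) by (simp add: power2_eq_square flip: r0(2))
      ultimately show ?thesis unfolding supersol_at_def using Wt[OF t, of x]
        by (intro exI[of _ "E * (d1 * Hyy (t + s) (r * x)) + \<Lambda> * W t x"]
              exI[of _ "\<lambda>y. E * (r * Hy (t + s) (r * y))"]
              exI[of _ "E * (r * (r * Hyy (t + s) (r * x)))"]) (auto simp: E_def)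
    qed
    show "\<exists>l r. (W t has_real_derivative l) (at 0 within {..0}) \<and>
         (W t has_real_derivative r) (at 0 within {0..}) \<and> \<sigma> * r \<le> l" if t: "0 < t" for t
    proof (intro exI conjI)
      define E where "E = exp (\<Lambda> * t)"
      have ts: "0 < t + s" using t s by simp
      have "((\<lambda>y. E * H (t + s) y) has_real_derivative E * Hy (t + s) 0) (at 0 within {..0})"
        by (intro DERIV_cmult has_field_derivative_at_within[OF Hy] ts)
      then show "(W t has_real_derivative 0) (at 0 within {..0})"
        unfolding even[OF ts] mult_zero_right
        by (rule has_field_derivative_transform_within[where d=1]) (auto simp: W_def E_def fold_line_def)
      have "((\<lambda>y. E * H (t + s) (r * y)) has_real_derivative E * (r * Hy (t + s) (r * 0))) (at 0)"
        by (intro DERIV_cmult sc1 Hy ts)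
      then have "((\<lambda>y. E * H (t + s) (r * y)) has_real_derivative 0) (at 0 within {0..})"
        using even[OF ts] by (simp add: has_field_derivative_at_within)
      then show "(W t has_real_derivative 0) (at 0 within {0..})"
        by (rule has_field_derivative_transform_within[where d=1]) (auto simp: W_def E_def fold_line_def)
    qed simp
  qed (rule t)
  then show ?thesis by (simp add: W_def)
qed

lemma integral_over_mesh:
  fixes f :: "real \<Rightarrow> real"
  assumes cont: "continuous_on UNIV f" and h: "0 \<le> h"
  shows "integral {a..a + real n * h} f = (\<Sum>j<n. integral {a + real j * h..a + real (Suc j) * h} f)"
proof (induction n)
  case (Suc n)
  have "integral {a..a + real n * h} f + integral {a + real n * h..a + real (Suc n) * h} f
      = integral {a..a + real (Suc n) * h} f"
  proof (rule Henstock_Kurzweil_Integration.integral_combine)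
    show "f integrable_on {a..a + real (Suc n) * h}"
      by (intro integrable_continuous_real continuous_on_subset[OF cont]) auto
  qed (use h in \<open>auto simp: algebra_simps\<close>)
  then show ?case using Suc by simp
qed simp

lemma integral_le_LINT_abs:
  fixes f :: "real \<Rightarrow> real"
  assumes cont: "continuous_on UNIV f" and nonneg: "\<And>x. 0 \<le> f x" and supp: "\<And>x. L \<le> \<bar>x\<bar> \<Longrightarrow> f x = 0"
  shows "integral {-L..L} f = (LINT x|lborel. \<bar>f x\<bar>)"
proof -
  have "continuous_on {-L..L} f" by (rule continuous_on_subset[OF cont]) simp
  then have "set_integrable lborel {-L..L} f" by (intro borel_integrable_atLeastAtMost') 
  then have "(LINT x:{-L..L}|lborel. f x) = integral {-L..L} f"
    by (rule set_borel_integral_eq_integral(2))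
  moreover have "indicator {-L..L} x *\<^sub>R f x = \<bar>f x\<bar>" for x
    using supp[of x] nonneg[of x]
    by (cases "L \<le> \<bar>x\<bar>") (auto simp: indicator_def not_le abs_less_iff)
  ultimately show ?thesis by (simp add: set_lebesgue_integral_def)
qed

lemma gauss_pos: "0 < gauss d \<tau> z"
  by (simp add: gauss_def)

text \<open>Gaussian smoothing from \<open>L\<^sup>1\<close> to pointwise bounds, by comparison with finitely many kernels. The support of
  \<open>u0\<close> is cut into cells of length \<open>h\<close>. On a cell, \<open>u0\<close> is, up to its oscillation \<open>\<omega>\<close>, at most a multiple of \<open>h u0(p)\<close>, with \<open>p\<close> the left end
  point, times the kernel of age \<open>h\<^sup>2\<close> centred at \<open>p\<close>, since that kernel is of size \<open>1 / h\<close> there. Reflected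
  copies of the kernels make the sum even. The sum of the weights is a Riemann sum of \<open>u0\<close>, and
  the errors vanish with \<open>\<omega>\<close>.\<close>

lemma L1_smoothing:
  assumes sol: "solution_P d1 d2 \<sigma> f1 f2 u0 u"
    and C1: "f1 C1_differentiable_on UNIV" "f2 C1_differentiable_on UNIV"
    and pos: "0 < d1" "0 < d2" "0 < \<sigma>"
    and lin: "\<And>v. 0 \<le> v \<Longrightarrow> f1 v \<le> \<Lambda> * v" "\<And>v. 0 \<le> v \<Longrightarrow> f2 v \<le> \<Lambda> * v"
    and r: "r = sqrt (d1 / d2)"
    and L: "0 < L" "\<And>x. L \<le> \<bar>x\<bar> \<Longrightarrow> u0 x = 0"
    and u0: "continuous_on UNIV u0" "\<And>x. 0 \<le> u0 x"
  shows "u 1 x \<le> 2 * exp \<Lambda> * exp ((max 1 r)\<^sup>2 / (4 * d1)) * (LINT x|lborel. \<bar>u0 x\<bar>) *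
    exp (- (max 0 (\<bar>fold_line r x\<bar> - max 1 r * L))\<^sup>2 / (8 * d1))"
    (is "_ \<le> 2 * exp \<Lambda> * ?K * ?m * ?g")
proof -
  let ?S = "max 1 r"
  have r0: "0 < r" using pos by (simp add: r)
  have approx: "u 1 x \<le> 2 * exp \<Lambda> * ?K * ?g * (?m + 4 * L * \<omega>)" if \<omega>: "0 < \<omega>" for \<omega>
  proof -
    have "uniformly_continuous_on {-L..L} u0"
      by (intro compact_uniformly_continuous continuous_on_subset[OF u0(1)]) auto
    then obtain \<delta> where \<delta>: "0 < \<delta>"
      "\<And>x y. x \<in> {-L..L} \<Longrightarrow> y \<in> {-L..L} \<Longrightarrow> dist y x < \<delta> \<Longrightarrow> dist (u0 y) (u0 x) < \<omega>"
      unfolding uniformly_continuous_on_def using \<omega> by metis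
    obtain n where n: "2 * L / min \<delta> 1 < real n" using reals_Archimedean2 by blast
    define h where "h = 2 * L / real n"
    have "0 < 2 * L / min \<delta> 1" using L \<delta> by simp
    then have n0: "0 < real n" using n by linarith
    have "2 * L < real n * min \<delta> 1" using n \<delta> by (simp add: field_simps)
    then have "h < min \<delta> 1"
      unfolding h_def pos_divide_less_eq[OF n0] by (simp only: mult.commute)
    then have h: "0 < h" "h < \<delta>" "h < 1" "real n * h = 2 * L" using L n0 by (auto simp: h_def)
    define p where "p j = - L + real j * h" for j
    have p: "p j \<in> {-L..L}" if "j \<le> n" for j
    proof -
      have "real j * h \<le> real n * h" using that h by (intro mult_right_mono) auto
      then show ?thesis using h by (simp add: p_def)
    qed
    have cell: "{p j..p (Suc j)} \<subseteq> {-L..L}" if "j < n" for j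
      using p[of j] p[of "Suc j"] that by auto
    have osc: "\<bar>u0 y - u0 (p j)\<bar> < \<omega>" if "j < n" "y \<in> {p j..p (Suc j)}" for j y
    proof -
      have "dist y (p j) < \<delta>" using that h by (simp add: p_def dist_real_def algebra_simps)
      then show ?thesis using \<delta>(2)[of "p j" y] p[of j] cell[of j] that by (auto simp: dist_real_def)
    qed
    \<comment> \<open>The factor \<open>exp (S\<^sup>2 / (4 d1))\<close>, with \<open>S\<close> the Lipschitz constant of the rescaling, offsets the
      smallest value of the kernel on its cell; \<open>\<omega>\<close> bounds the oscillation of \<open>u0\<close> on a cell.\<close>
    define c where "c j = ?K * (h * (u0 (p j) + \<omega>))" for j
    have c0: "0 \<le> c j" for j using u0(2)[of "p j"] h \<omega> by (simp add: c_def)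
    define y where "y j = fold_line r (p j)" for j
    define s where "s = h\<^sup>2"
    have s: "0 < s" "s \<le> 1" using h by (auto simp: s_def power_le_one)
    define H where "H \<tau> z = (\<Sum>j<n. c j * (gauss d1 \<tau> (z - y j) + gauss d1 \<tau> (z + y j)))" for \<tau> z
    define G1 where "G1 \<tau> z = - z / (2 * d1 * \<tau>) * gauss d1 \<tau> z" for \<tau> z
    define G2 where "G2 \<tau> z = (z\<^sup>2 / (4 * d1\<^sup>2 * \<tau>\<^sup>2) - 1 / (2 * d1 * \<tau>)) * gauss d1 \<tau> z" for \<tau> z
    define Hy where "Hy \<tau> z = (\<Sum>j<n. c j * (G1 \<tau> (z - y j) + G1 \<tau> (z + y j)))" for \<tau> z
    define Hyy where "Hyy \<tau> z = (\<Sum>j<n. c j * (G2 \<tau> (z - y j) + G2 \<tau> (z + y j)))" for \<tau> z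
    have gt: "((\<lambda>\<tau>. gauss d1 \<tau> z) has_real_derivative d1 * G2 \<tau> z) (at \<tau>)" if "0 < \<tau>" for \<tau> z
      using gauss_derivs(1)[OF pos(1) that] by (simp add: G2_def)
    have gz: "((\<lambda>z. gauss d1 \<tau> (z + a)) has_real_derivative G1 \<tau> (z + a)) (at z)" if "0 < \<tau>" for \<tau> z a
      using gauss_derivs(2)[OF pos(1) that, of "z + a"] by (simp add: G1_def DERIV_shift[of "gauss d1 \<tau>"])
    have gzz: "((\<lambda>z. G1 \<tau> (z + a)) has_real_derivative G2 \<tau> (z + a)) (at z)" if "0 < \<tau>" for \<tau> z a
      using gauss_derivs(3)[OF pos(1) that, of "z + a"] unfolding G1_def G2_def
      by (simp only: DERIV_shift[of "\<lambda>z. - z / (2 * d1 * \<tau>) * gauss d1 \<tau> z"])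
    have hit: "u0 z \<le> H s (fold_line r z)" for z
    proof (cases "L \<le> \<bar>z\<bar>")
      case True
      have "0 \<le> H s (fold_line r z)" unfolding H_def
        by (intro sum_nonneg mult_nonneg_nonneg c0 add_nonneg_nonneg less_imp_le[OF gauss_pos])
      then show ?thesis using L(2)[OF True] by simp
    next
      case False
      define j where "j = nat \<lfloor>(z + L) / h\<rfloor>"
      have z: "0 \<le> (z + L) / h" "(z + L) / h < real n"
        using False h by (auto simp: field_simps)
      have j1: "real j \<le> (z + L) / h" "(z + L) / h < real (Suc j)"
        using z(1) unfolding j_def by linarith+
      have "real j < real n" using j1(1) z(2) by linarith
      moreover have "z \<in> {p j..p (Suc j)}" using j1 h by (auto simp: p_def field_simps)
      ultimately have j: "j < n" "z \<in> {p j..p (Suc j)}" by auto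
      have "gauss d1 s (fold_line r z - y j) \<ge> 1 / h * (1 / ?K)"
      proof -
        have "\<bar>fold_line r z - y j\<bar> \<le> ?S * \<bar>z - p j\<bar>"
          unfolding y_def by (rule fold_line_lipschitz[OF r0])
        also have "\<dots> \<le> ?S * h" using j h by (intro mult_left_mono) (auto simp: p_def algebra_simps)
        finally have "(fold_line r z - y j)\<^sup>2 \<le> (?S * h)\<^sup>2"
          by (metis abs_ge_zero power2_abs power_mono)
        then have "(fold_line r z - y j)\<^sup>2 / (4 * d1 * s) \<le> (?S * h)\<^sup>2 / (4 * d1 * s)"
          using pos s by (intro divide_right_mono) auto
        also have "\<dots> = ?S\<^sup>2 / (4 * d1)" using h pos by (simp add: s_def power_mult_distrib)
        finally have "- ln s / 2 - ?S\<^sup>2 / (4 * d1) \<le> - ln s / 2 - (fold_line r z - y j)\<^sup>2 / (4 * d1 * s)"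
          by simp
        moreover have "- ln s / 2 = - ln h" using h by (simp add: s_def ln_realpow)
        ultimately have "exp (- ln h - ?S\<^sup>2 / (4 * d1)) \<le> gauss d1 s (fold_line r z - y j)"
          unfolding gauss_def by simp
        moreover have "exp (- ln h - ?S\<^sup>2 / (4 * d1)) = 1 / h * (1 / ?K)"
          using h by (simp add: exp_diff exp_minus field_simps)
        ultimately show ?thesis by simp
      qed
      then have "c j * (1 / h * (1 / ?K)) \<le> c j * gauss d1 s (fold_line r z - y j)"
        by (intro mult_left_mono c0)
      also have "\<dots> \<le> c j * (gauss d1 s (fold_line r z - y j) + gauss d1 s (fold_line r z + y j))"
        using gauss_pos[of d1 s "fold_line r z + y j"] by (intro mult_left_mono c0) auto
      also have "\<dots> \<le> H s (fold_line r z)"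
        unfolding H_def using j(1)
        by (intro member_le_sum mult_nonneg_nonneg c0 add_nonneg_nonneg less_imp_le[OF gauss_pos]) auto
      finally have "u0 (p j) + \<omega> \<le> H s (fold_line r z)" using h by (simp add: c_def)
      then show ?thesis using osc[OF j] by linarith
    qed
    have "u 1 x \<le> exp (\<Lambda> * 1) * H (1 + s) (fold_line r x)"
    proof (rule folded_heat_supersolution[OF sol C1 pos lin s(1) r, where H=H and Hy=Hy and Hyy=Hyy])
      show "continuous_on ({0<..} \<times> UNIV) (\<lambda>(\<tau>, y). H \<tau> y)"
        unfolding H_def gauss_def case_prod_beta using pos by (intro continuous_intros) auto
      show "0 \<le> H \<tau> z" for \<tau> z unfolding H_def
        by (intro sum_nonneg mult_nonneg_nonneg c0 add_nonneg_nonneg less_imp_le[OF gauss_pos])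
      show "((\<lambda>\<tau>. H \<tau> z) has_real_derivative d1 * Hyy \<tau> z) (at \<tau>)" if "0 < \<tau>" for \<tau> z
      proof -
        have "((\<lambda>\<tau>. H \<tau> z) has_real_derivative
            (\<Sum>j<n. c j * (d1 * G2 \<tau> (z - y j) + d1 * G2 \<tau> (z + y j)))) (at \<tau>)"
          unfolding H_def by (intro DERIV_sum DERIV_cmult DERIV_add gt that)
        then show ?thesis by (simp add: Hyy_def sum_distrib_left algebra_simps)
      qed
      show "(H \<tau> has_real_derivative Hy \<tau> z) (at z)" if "0 < \<tau>" for \<tau> z
        unfolding H_def Hy_def using gz[OF that, of "- y _" z] gz[OF that, of "y _" z]
        by (intro DERIV_sum DERIV_cmult DERIV_add) auto
      show "(Hy \<tau> has_real_derivative Hyy \<tau> z) (at z)" if "0 < \<tau>" for \<tau> z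
        unfolding Hy_def Hyy_def using gzz[OF that, of "- y _" z] gzz[OF that, of "y _" z]
        by (intro DERIV_sum DERIV_cmult DERIV_add) auto
      show "Hy \<tau> 0 = 0" for \<tau> by (simp add: Hy_def G1_def gauss_def)
    qed (use hit in auto)
    also have "H (1 + s) (fold_line r x) \<le> (\<Sum>j<n. c j * (?g + ?g))"
      unfolding H_def
    proof (intro sum_mono mult_left_mono add_mono c0)
      fix j assume "j \<in> {..<n}"
      then have "\<bar>p j\<bar> \<le> L" using p[of j] by (auto simp: abs_le_iff)
      then have "?S * \<bar>p j - 0\<bar> \<le> ?S * L" by (intro mult_left_mono) auto
      then have yj: "\<bar>y j\<bar> \<le> ?S * L"
        using fold_line_lipschitz[OF r0, of "p j" 0] by (simp add: y_def fold_line_def[of r 0])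
      have tail: "gauss d1 (1 + s) z \<le> ?g" if z: "\<bar>fold_line r x\<bar> - ?S * L \<le> \<bar>z\<bar>" for z
      proof -
        have "(max 0 (\<bar>fold_line r x\<bar> - ?S * L))\<^sup>2 \<le> \<bar>z\<bar>\<^sup>2" using z by (intro power_mono) auto
        then have "(max 0 (\<bar>fold_line r x\<bar> - ?S * L))\<^sup>2 / (8 * d1) \<le> z\<^sup>2 / (8 * d1)"
          using pos by (intro divide_right_mono) auto
        also have "\<dots> \<le> z\<^sup>2 / (4 * d1 * (1 + s))"
          using pos s by (intro divide_left_mono) auto
        finally have le: "(max 0 (\<bar>fold_line r x\<bar> - ?S * L))\<^sup>2 / (8 * d1) \<le> z\<^sup>2 / (4 * d1 * (1 + s))" .
        have "0 \<le> ln (1 + s)" using s by simp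
        with le have "- ln (1 + s) / 2 - z\<^sup>2 / (4 * d1 * (1 + s))
            \<le> - (max 0 (\<bar>fold_line r x\<bar> - ?S * L))\<^sup>2 / (8 * d1)"
          unfolding minus_divide_left[symmetric] by linarith
        then show ?thesis unfolding gauss_def by simp
      qed
      show "gauss d1 (1 + s) (fold_line r x - y j) \<le> ?g" "gauss d1 (1 + s) (fold_line r x + y j) \<le> ?g"
        using yj by (intro tail; linarith)+
    qed
    also have "\<dots> = 2 * ?g * ?K * (\<Sum>j<n. h * (u0 (p j) + \<omega>))"
      unfolding c_def sum_distrib_left by (intro sum.cong refl) (simp add: algebra_simps)
    also have "(\<Sum>j<n. h * (u0 (p j) + \<omega>)) \<le> (\<Sum>j<n. integral {p j..p (Suc j)} u0 + 2 * h * \<omega>)"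
    proof (intro sum_mono)
      fix j assume j: "j \<in> {..<n}"
      have len: "p (Suc j) - p j = h" by (simp add: p_def algebra_simps)
      have "integral {p j..p (Suc j)} (\<lambda>_. u0 (p j) - \<omega>) \<le> integral {p j..p (Suc j)} u0"
      proof (rule integral_le)
        show "u0 integrable_on {p j..p (Suc j)}"
          by (intro integrable_continuous_real continuous_on_subset[OF u0(1)]) auto
        show "u0 (p j) - \<omega> \<le> u0 y" if "y \<in> {p j..p (Suc j)}" for y
          using osc[of j y] j that by auto
      qed auto
      then show "h * (u0 (p j) + \<omega>) \<le> integral {p j..p (Suc j)} u0 + 2 * h * \<omega>"
        using len h by (simp add: algebra_simps)
    qed
    also have "\<dots> = ?m + 4 * L * \<omega>"
    proof -
      have "(\<Sum>j<n. integral {p j..p (Suc j)} u0) = integral {- L..- L + real n * h} u0"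
        using integral_over_mesh[OF u0(1), of h "- L" n] h by (simp add: p_def)
      also have "\<dots> = ?m" using integral_le_LINT_abs[OF u0 L(2)] h by simp
      finally have "(\<Sum>j<n. integral {p j..p (Suc j)} u0 + 2 * h * \<omega>) = ?m + real n * (2 * h * \<omega>)"
        by (simp add: sum.distrib)
      also have "real n * (2 * h * \<omega>) = 4 * L * \<omega>"
        using h(4) by (metis (no_types, opaque_lifting) mult.assoc mult.commute mult_2 numeral_Bit0 mult_numeral_1 distrib_right)
      finally show ?thesis .
    qed
    finally show ?thesis by (simp add: algebra_simps)
  qed
  show ?thesis
  proof (rule field_le_epsilon)
    fix e :: real assume "0 < e"
    define A where "A = 2 * exp \<Lambda> * ?K * ?g"
    have A: "0 < A" by (simp add: A_def)
    have "u 1 x \<le> A * (?m + 4 * L * (e / (A * (4 * L))))"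
      unfolding A_def using L \<open>0 < e\<close> by (intro approx) simp
    also have "\<dots> = 2 * exp \<Lambda> * ?K * ?m * ?g + e" using A L by (simp add: A_def field_simps)
    finally show "u 1 x \<le> 2 * exp \<Lambda> * ?K * ?m * ?g + e" .
  qed
qed

section \<open>Blocking for small initial mass\<close>

lemma bistable_linear_growth:
  assumes C1: "f C1_differentiable_on UNIV" and bi: "bistable f \<theta> K"
  shows "\<exists>\<Lambda>>0. \<forall>v\<ge>0. f v \<le> \<Lambda> * v"
proof -
  note b = bistableD[OF bi]
  obtain k where k: "k > 0" "\<forall>s\<in>{0..K}. \<forall>r\<in>{0..K}. \<bar>f s - f r\<bar> \<le> k * \<bar>s - r\<bar>"
    using C1_lipschitz[OF C1, of 0 K] by blast
  have "f v \<le> k * v" if "0 \<le> v" for v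
  proof (cases "v \<le> K")
    case True
    have "\<bar>f v - f 0\<bar> \<le> k * \<bar>v - 0\<bar>" using True that b(1,2) by (intro k(2)[rule_format]) auto
    then show ?thesis using b(3) that by simp
  next
    case False
    then have "f v < 0" using b(9) by simp
    also have "0 \<le> k * v" using k that by simp
    finally show ?thesis by simp
  qed
  with k(1) show ?thesis by blast
qed

lemma gaussian_tail_below_exponential:
  fixes d r \<kappa> x Y :: real
  assumes "0 < d" "0 < r" "0 < \<kappa>" "0 \<le> x"
  shows "exp (- (max 0 (r * x - Y))\<^sup>2 / (8 * d)) \<le> exp (\<kappa> * Y / r + 2 * d * \<kappa>\<^sup>2 / r\<^sup>2) * exp (- \<kappa> * x)"
proof -
  define a where "a = max 0 (r * x - Y)"
  define b where "b = \<kappa> / r"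
  \<comment> \<open>The maximum of \<open>b a - a\<^sup>2 / (8 d)\<close> over \<open>a\<close> is \<open>2 d b\<^sup>2\<close>, attained at \<open>a = 4 d b\<close>.\<close>
  have "0 \<le> (a - 4 * d * b)\<^sup>2 / (8 * d)" using assms by simp
  also have "\<dots> = a\<^sup>2 / (8 * d) - b * a + 2 * d * b\<^sup>2"
    using assms by (simp add: field_simps power2_eq_square)
  finally have 1: "b * a \<le> a\<^sup>2 / (8 * d) + 2 * d * b\<^sup>2" by linarith
  have "b * (r * x) \<le> b * (a + Y)" using assms by (intro mult_left_mono) (auto simp: a_def b_def)
  then have "\<kappa> * x \<le> b * a + b * Y" using assms by (simp add: b_def field_simps)
  with 1 have "- a\<^sup>2 / (8 * d) \<le> b * Y + 2 * d * b\<^sup>2 + - \<kappa> * x"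
    unfolding minus_divide_left[symmetric] by linarith
  then have "exp (- a\<^sup>2 / (8 * d)) \<le> exp (b * Y + 2 * d * b\<^sup>2 + - \<kappa> * x)" by (rule exp_le_cancel_iff[THEN iffD2])
  also have "\<dots> = exp (b * Y + 2 * d * b\<^sup>2) * exp (- \<kappa> * x)" by (rule exp_add)
  also have "b * Y + 2 * d * b\<^sup>2 = \<kappa> * Y / r + 2 * d * \<kappa>\<^sup>2 / r\<^sup>2" by (simp add: b_def power_divide)
  finally show ?thesis by (simp only: a_def)
qed

lemma bounded_by_stationary:
  assumes sol: "solution_P d1 d2 \<sigma> f1 f2 u0 u"
    and C1: "f1 C1_differentiable_on UNIV" "f2 C1_differentiable_on UNIV"
    and pos: "0 < d1" "0 < d2" "0 < \<sigma>" "0 \<le> t0"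
    and stat: "stationary_solution d1 d2 \<sigma> f1 f2 U" and nonneg: "\<And>x. 0 \<le> U x"
    and init: "\<And>x. u t0 x \<le> U x" and t: "t0 \<le> t"
  shows "u t x \<le> U x"
proof -
  have contU: "continuous_on UNIV U" using stat by (simp add: stationary_solution_def)
  from stat obtain U1' U1'' U2' U2'' where
    D1: "C2_derivs {..0} U U1' U1''" and D2: "C2_derivs {0..} U U2' U2''"
    and eq1: "\<And>x. x < 0 \<Longrightarrow> d1 * U1'' x + f1 (U x) = 0"
    and eq2: "\<And>x. 0 < x \<Longrightarrow> d2 * U2'' x + f2 (U x) = 0"
    and fl: "U1' 0 = \<sigma> * U2' 0"
    unfolding stationary_solution_def by blast
  show ?thesis
  proof (rule comparison_principle[OF sol C1 pos, where W="\<lambda>_. U"])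
    show "continuous_on ({t0..} \<times> UNIV) (\<lambda>(t :: real, x). U x)"
      unfolding case_prod_beta by (intro continuous_on_compose2[OF contU]) (auto intro!: continuous_intros)
    show "supersol_at d1 f1 (\<lambda>_. U) t x" if x: "x < 0" for t x
    proof -
      have "\<forall>\<^sub>F y in nhds x. (U has_real_derivative U1' y) (at y)"
        using x by (intro eventually_nhds_in_open[THEN eventually_mono, of "{..<0}"])
          (auto intro!: C2_derivs_interior[OF D1])
      moreover have "(U1' has_real_derivative U1'' x) (at x)"
        using x by (intro C2_derivs_interior[OF D1]) auto
      ultimately show ?thesis unfolding supersol_at_def using eq1[OF x]
        by (intro exI[of _ 0] exI[of _ U1'] exI[of _ "U1'' x"]) auto
    qed
    show "supersol_at d2 f2 (\<lambda>_. U) t x" if x: "0 < x" for t x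
    proof -
      have "\<forall>\<^sub>F y in nhds x. (U has_real_derivative U2' y) (at y)"
        using x by (intro eventually_nhds_in_open[THEN eventually_mono, of "{0<..}"])
          (auto intro!: C2_derivs_interior[OF D2])
      moreover have "(U2' has_real_derivative U2'' x) (at x)"
        using x by (intro C2_derivs_interior[OF D2]) auto
      ultimately show ?thesis unfolding supersol_at_def using eq2[OF x]
        by (intro exI[of _ 0] exI[of _ U2'] exI[of _ "U2'' x"]) auto
    qed
    show "\<exists>l r. (U has_real_derivative l) (at 0 within {..0}) \<and>
         (U has_real_derivative r) (at 0 within {0..}) \<and> \<sigma> * r \<le> l"
    proof (rule exI[of _ "U1' 0"], rule exI[of _ "U2' 0"])
      have "(U has_real_derivative U1' 0) (at 0 within {..0})"
        "(U has_real_derivative U2' 0) (at 0 within {0..})"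
        using D1 D2 by (simp_all add: C2_derivs_def)
      then show "(U has_real_derivative U1' 0) (at 0 within {..0}) \<and>
         (U has_real_derivative U2' 0) (at 0 within {0..}) \<and> \<sigma> * U2' 0 \<le> U1' 0"
        using fl by simp
    qed
  qed (use nonneg init t in auto)
qed

text \<open>At time \<open>1\<close> the solution has a Gaussian tail proportional to its initial mass, whereas \<open>U\<close> is bounded
  below in patch 1 and decays no faster than an exponential in patch 2. Small mass thus puts \<open>u\<close> below \<open>U\<close> at
  time \<open>1\<close>, and the order persists. The constants come from one admissible \<open>\<sigma>0\<close>; they concern \<open>U\<close> alone,
  and the smoothing bound is uniform in \<open>\<sigma>\<close>. If no \<open>\<sigma>0\<close> is admissible, the claim is vacuous.\<close>

lemma blocked_if_small_mass:
  assumes C1: "f1 C1_differentiable_on UNIV" "f2 C1_differentiable_on UNIV"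
    and d: "0 < d1" "0 < d2"
    and bi1: "bistable f1 \<theta>1 K1" and bi2: "bistable f2 \<theta>2 K2"
    and nonneg: "\<And>x. 0 \<le> U x" and lim: "(U \<longlongrightarrow> K1) at_bot" "(U \<longlongrightarrow> 0) at_top"
    and L: "0 < L"
  shows "\<exists>\<epsilon>>0. \<forall>\<sigma> u0 u. 0 < \<sigma> \<longrightarrow> stationary_solution d1 d2 \<sigma> f1 f2 U \<longrightarrow>
           admissible_datum u0 \<longrightarrow> solution_P d1 d2 \<sigma> f1 f2 u0 u \<longrightarrow>
           closure {x. u0 x \<noteq> 0} \<subseteq> {-L..L} \<longrightarrow> (LINT x|lborel. \<bar>u0 x\<bar>) \<le> \<epsilon> \<longrightarrow>
           blocked_in_patch2 u"
proof (cases "\<exists>\<sigma>0>0. stationary_solution d1 d2 \<sigma>0 f1 f2 U")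
  case False
  then show ?thesis by (intro exI[of _ 1]) auto
next
  case True
  note b1 = bistableD[OF bi1] and b2 = bistableD[OF bi2]
  have K1: "0 < K1" using b1 by simp
  from True obtain \<sigma>0 where \<sigma>0: "0 < \<sigma>0" "stationary_solution d1 d2 \<sigma>0 f1 f2 U" by blast
  obtain c \<kappa> where c: "0 < c" "0 < \<kappa>" "\<forall>x\<le>0. c \<le> U x" "\<forall>x\<ge>0. c * exp (- \<kappa> * x) \<le> U x"
    using stationary_lower_bound[OF \<sigma>0(2) C1 d \<sigma>0(1) b1(3) b2(3) nonneg K1 lim] by blast
  obtain \<Lambda>1 where \<Lambda>1: "\<Lambda>1 > 0" "\<forall>v\<ge>0. f1 v \<le> \<Lambda>1 * v" using bistable_linear_growth[OF C1(1) bi1] by blast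
  obtain \<Lambda>2 where \<Lambda>2: "\<Lambda>2 > 0" "\<forall>v\<ge>0. f2 v \<le> \<Lambda>2 * v" using bistable_linear_growth[OF C1(2) bi2] by blast
  define \<Lambda> where "\<Lambda> = max \<Lambda>1 \<Lambda>2"
  have lin: "f1 v \<le> \<Lambda> * v" "f2 v \<le> \<Lambda> * v" if "0 \<le> v" for v
  proof -
    have "\<Lambda>1 * v \<le> \<Lambda> * v" "\<Lambda>2 * v \<le> \<Lambda> * v" using that by (auto simp: \<Lambda>_def intro!: mult_right_mono)
    then show "f1 v \<le> \<Lambda> * v" "f2 v \<le> \<Lambda> * v" using \<Lambda>1 \<Lambda>2 that by (meson order_trans)+
  qed
  define r where "r = sqrt (d1 / d2)"
  have r: "0 < r" using d by (simp add: r_def)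
  define Y where "Y = max 1 r * (L + 1)"
  define C where "C = 2 * exp \<Lambda> * exp ((max 1 r)\<^sup>2 / (4 * d1))"
  define D where "D = exp (\<kappa> * Y / r + 2 * d1 * \<kappa>\<^sup>2 / r\<^sup>2)"
  have C: "0 < C" by (simp add: C_def)
  have Y: "0 < Y" using L by (simp add: Y_def)
  have D: "1 \<le> D" using c Y r d by (simp add: D_def)
  define \<epsilon> where "\<epsilon> = c / (C * D)"
  have \<epsilon>: "0 < \<epsilon>" "C * \<epsilon> * D = c" using c C D by (auto simp: \<epsilon>_def)
  show ?thesis
  proof (intro exI[of _ \<epsilon>] conjI \<epsilon>(1) allI impI)
    fix \<sigma> u0 u
    assume \<sigma>: "0 < \<sigma>" and stat: "stationary_solution d1 d2 \<sigma> f1 f2 U"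
      and adm: "admissible_datum u0" and sol: "solution_P d1 d2 \<sigma> f1 f2 u0 u"
      and supp: "closure {x. u0 x \<noteq> 0} \<subseteq> {-L..L}" and small: "(LINT x|lborel. \<bar>u0 x\<bar>) \<le> \<epsilon>"
    have u0: "continuous_on UNIV u0" "\<And>x. 0 \<le> u0 x" using adm by (auto simp: admissible_datum_def)
    have supp': "u0 x = 0" if "L + 1 \<le> \<bar>x\<bar>" for x
    proof (rule ccontr)
      assume "u0 x \<noteq> 0"
      then have "x \<in> closure {x. u0 x \<noteq> 0}" by (intro subsetD[OF closure_subset]) simp
      then have "x \<in> {-L..L}" using supp by blast
      then show False using that by auto
    qed
    have L1: "0 < L + 1" using L by simp
    obtain y0 where y0: "\<And>x. u0 x \<le> u0 y0" using admissible_datum_attains_max[OF adm] by blast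
    define M where "M = max (max K1 K2) (u0 y0) + 1"
    have M: "K1 < M" "K2 < M" "\<And>x. u0 x \<le> M" by (auto simp: M_def intro: order_trans[OF y0])
    then have M0: "0 < M" using K1 by simp
    have uM: "u t x \<le> M" if "0 \<le> t" for t x
      using bounded_by_constant_supersolution[OF sol C1 d \<sigma> _ _ _ M(3) that] b1(9)[of M] b2(9)[of M] M M0
      by simp
    have at1: "u 1 x \<le> U x" for x
    proof -
      define g where "g = exp (- (max 0 (\<bar>fold_line r x\<bar> - max 1 r * (L + 1)))\<^sup>2 / (8 * d1))"
      have g1: "0 < g" "g \<le> 1" using d by (auto simp: g_def)
      have "u 1 x \<le> C * (LINT x|lborel. \<bar>u0 x\<bar>) * g"
        unfolding C_def g_def
        by (rule L1_smoothing[OF sol C1 d \<sigma> lin r_def L1 supp' u0])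
      also have "\<dots> \<le> C * \<epsilon> * g" using C g1 small by (intro mult_right_mono mult_left_mono) auto
      also have "\<dots> \<le> U x"
      proof (cases "x \<le> 0")
        case True
        have "C * \<epsilon> * g \<le> C * \<epsilon> * D" using g1 D C \<epsilon> by (intro mult_left_mono) auto
        also have "\<dots> \<le> U x" using c(3) True \<epsilon>(2) by simp
        finally show ?thesis .
      next
        case False
        have "fold_line r x = r * x" "0 \<le> r * x" using False r by (auto simp: fold_line_def)
        then have "g = exp (- (max 0 (r * x - Y))\<^sup>2 / (8 * d1))" by (simp add: g_def Y_def)
        also have "\<dots> \<le> D * exp (- \<kappa> * x)"
          unfolding D_def using False by (intro gaussian_tail_below_exponential d r c) auto
        finally have "C * \<epsilon> * g \<le> C * \<epsilon> * (D * exp (- \<kappa> * x))"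
          using C \<epsilon> by (intro mult_left_mono) auto
        also have "\<dots> = c * exp (- \<kappa> * x)" by (simp only: \<epsilon>(2)[symmetric] mult.assoc)
        also have "\<dots> \<le> U x" using c(4) False by simp
        finally show ?thesis .
      qed
      finally show ?thesis .
    qed
    have uU: "u t x \<le> U x" if "1 \<le> t" for t x
      by (rule bounded_by_stationary[OF sol C1 d \<sigma> _ stat nonneg at1 that]) simp
    show "blocked_in_patch2 u"
    proof (rule blocked_in_patch2I)
      show "0 \<le> u t x" if "0 \<le> t" for t x using solution_P_nonneg[OF sol that] .
      fix e :: real assume e: "0 < e"
      have s0: "u0 x = 0" if "L + 1 \<le> x" for x using supp'[of x] that by simp
      have "\<exists>X. \<forall>x\<ge>X. \<forall>t. 0 \<le> t \<and> t \<le> 1 \<longrightarrow> u t x < e"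
        by (rule uniform_decay_on_bounded_times[OF sol C1 d \<sigma> b2(3) M0 uM L1 s0 e])
      then obtain X1 where X1: "\<forall>x\<ge>X1. \<forall>t. 0 \<le> t \<and> t \<le> 1 \<longrightarrow> u t x < e" by blast
      have "\<forall>\<^sub>F x in at_top. U x < e" using lim(2) e by (intro order_tendstoD) auto
      then obtain X2 where X2: "\<forall>x\<ge>X2. U x < e" unfolding eventually_at_top_linorder by blast
      have "u t x < e" if "max X1 X2 \<le> x" "0 \<le> t" for t x
      proof (cases "t \<le> 1")
        case True then show ?thesis using X1 that by simp
      next
        case False
        then have "u t x \<le> U x" by (intro uU) simp
        also have "U x < e" using X2 that by simp
        finally show ?thesis .
      qed
      then show "\<exists>X. \<forall>x\<ge>X. \<forall>t\<ge>0. u t x < e" by blast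
    qed
  qed
qed

section \<open>Blocking in patch 2\<close>

theorem theorem2p16:
  fixes d1 d2 K1 K2 \<theta>1 \<theta>2 :: real and f1 f2 :: "real \<Rightarrow> real"
  assumes "0 < d1" and "0 < d2" and "0 < K1" and "0 < K2"
    and "f1 C1_differentiable_on UNIV" and "f2 C1_differentiable_on UNIV"
    and "bistable f1 \<theta>1 K1" and "bistable f2 \<theta>2 K2"
  shows
    "(\<forall>\<sigma> u0 u. 0 < \<sigma> \<longrightarrow> admissible_datum u0 \<longrightarrow> solution_P d1 d2 \<sigma> f1 f2 u0 u \<longrightarrow>
        integral {0..K2} f2 < 0 \<or>
        (integral {0..K2} f2 = 0 \<and> K1 < K2) \<or>
        (K1 < \<theta>2 \<and> (\<forall>x. u0 x < \<theta>2)) \<longrightarrow>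
        blocked_in_patch2 u) \<and>
     (\<forall>U L. (\<forall>x. 0 \<le> U x) \<longrightarrow> (U \<longlongrightarrow> K1) at_bot \<longrightarrow> (U \<longlongrightarrow> 0) at_top \<longrightarrow> 0 < L \<longrightarrow>
        (\<exists>\<epsilon>>0. \<forall>\<sigma> u0 u. 0 < \<sigma> \<longrightarrow> stationary_solution d1 d2 \<sigma> f1 f2 U \<longrightarrow>
           admissible_datum u0 \<longrightarrow> solution_P d1 d2 \<sigma> f1 f2 u0 u \<longrightarrow>
           closure {x. u0 x \<noteq> 0} \<subseteq> {-L..L} \<longrightarrow> (LINT x|lborel. \<bar>u0 x\<bar>) \<le> \<epsilon> \<longrightarrow>
           blocked_in_patch2 u))"
proof (intro conjI allI impI)
  fix \<sigma> u0 u
  assume a: "0 < \<sigma>" "admissible_datum u0" "solution_P d1 d2 \<sigma> f1 f2 u0 u"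
    and "integral {0..K2} f2 < 0 \<or> (integral {0..K2} f2 = 0 \<and> K1 < K2) \<or> (K1 < \<theta>2 \<and> (\<forall>x. u0 x < \<theta>2))"
  then consider "integral {0..K2} f2 < 0" | "integral {0..K2} f2 = 0" "K1 < K2"
    | "K1 < \<theta>2" "\<And>x. u0 x < \<theta>2" by blast
  then show "blocked_in_patch2 u"
  proof cases
    case 1
    then show ?thesis by (rule blocked_if_unbalanced[OF a(3) assms(5,6,1,2) a(1) assms(7,8) _ a(2)])
  next
    case 2
    then show ?thesis by (rule blocked_if_balanced[OF a(3) assms(5,6,1,2) a(1) assms(7,8) _ _ a(2)])
  next
    case 3
    then show ?thesis by (rule blocked_if_below_threshold[OF a(3) assms(5,6,1,2) a(1) assms(7,8) _ _ a(2)])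
  qed
next
  fix U :: "real \<Rightarrow> real" and L :: real
  assume "\<forall>x. 0 \<le> U x" "(U \<longlongrightarrow> K1) at_bot" "(U \<longlongrightarrow> 0) at_top" "0 < L"
  then show "\<exists>\<epsilon>>0. \<forall>\<sigma> u0 u. 0 < \<sigma> \<longrightarrow> stationary_solution d1 d2 \<sigma> f1 f2 U \<longrightarrow>
           admissible_datum u0 \<longrightarrow> solution_P d1 d2 \<sigma> f1 f2 u0 u \<longrightarrow>
           closure {x. u0 x \<noteq> 0} \<subseteq> {-L..L} \<longrightarrow> (LINT x|lborel. \<bar>u0 x\<bar>) \<le> \<epsilon> \<longrightarrow>
           blocked_in_patch2 u"
    by (intro blocked_if_small_mass[OF assms(5,6,1,2,7,8)]) auto
qed

end
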